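(* Let $\mathcal A=\mathbb K[x_1,\dots,x_n]$ be a quasi-regular Poisson algebra of index $l$ and let $\{Q_1,\dots,Q_l\}\subset Z(\mathcal A)$ be an admissible set. Then $\pi^{(n-l)/2}=\lambda\, j_{dQ_1\wedge\dots\wedge dQ_l}(\partial_1\wedge\dots\wedge\partial_n)$ for some nonzero $\lambda\in\mathbb K$.
   Context: $\mathbb K$ is algebraically closed of characteristic $0$. Let $W$ be the free $\mathcal A$-module of derivations of $\mathcal A$, with basis $\partial_i=\partial/\partial x_i$, let $\Omega^1=\mathrm{Hom}_{\mathcal A}(W,\mathcal A)$ and $\Omega=\bigoplus_k\Omega^k$ its exterior algebra, with $d$ the exterior differential. $\Omega^k$ and $\bigwedge^k_{\mathcal A}W$ are paired by $\langle\alpha_1\wedge\dots\wedge\alpha_k,D_1\wedge\dots\wedge D_k\rangle=\det(\alpha_i(D_j))$. For $\omega\in\Omega^p$, $j_\omega$ is the $\mathcal A$-linear endomorphism of $\bigwedge_{\mathcal A}W$ of degree $-p$ with $\langle\eta,j_\omega(D)\rangle=\langle\eta\wedge\omega,D\rangle$ for all $\eta\in\Omega$, $D\in\bigwedge_{\mathcal A}W$. A Poisson bracket on $\mathcal A$ is encoded by its bivector $\pi\in\bigwedge^2_{\mathcal A}W$ with $\langle df\wedge dg,\pi\rangle=\{f,g\}$; $\pi^k$ is the $k$-fold wedge power. $\mathrm{rk}\,\pi(\xi)$ is the rank of the matrix $(\{x_i,x_j\})$ at $\xi\in\mathbb A^n$; the index is ${\rm ind}\,\mathcal A=n-\max_\xi\mathrm{rk}\,\pi(\xi)$;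 $\mathrm{Sing}\,\pi=\{\xi:\mathrm{rk}\,\pi(\xi)<n-{\rm ind}\,\mathcal A\}$; $Z(\mathcal A)$ is the Poisson centre. The Jacobian locus $\mathcal J(g_1,\dots,g_m)$ is the set of $\xi$ where $d_\xi g_1,\dots,d_\xi g_m$ are linearly dependent. A subset $\{Q_1,\dots,Q_l\}\subset Z(\mathcal A)$ is admissible if $l={\rm ind}\,\mathcal A$ and $\mathcal J(Q_1,\dots,Q_l)$ has codimension $\ge2$ in $\mathbb A^n$. $\mathcal A$ is quasi-regular if $Z(\mathcal A)$ contains an admissible subset and $\mathrm{Sing}\,\pi$ has codimension $\ge 2$ in $\mathbb A^n$. *)

theory Defs
  imports "HOL-Library.Poly_Mapping" "HOL-Computational_Algebra.Polynomial"
begin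

text \<open>A polynomial is a finitely supported map from monomials (exponent vectors
  nat =>0 nat) to coefficients.  The algebra A = K[x_1..x_n] is the subring of
  polynomials involving only the variables with index < n (we index from 0).\<close>

type_synonym 'a mpoly = "(nat \<Rightarrow>\<^sub>0 nat) \<Rightarrow>\<^sub>0 'a"

definition polyA :: "nat \<Rightarrow> 'a::comm_ring_1 mpoly set" where
  "polyA n = {p. \<forall>m\<in>Poly_Mapping.keys p. Poly_Mapping.keys m \<subseteq> {..<n}}"

definition Var :: "nat \<Rightarrow> 'a::comm_ring_1 mpoly" where
  "Var i = Poly_Mapping.single (Poly_Mapping.single i 1) 1"

definition Const :: "'a::comm_ring_1 \<Rightarrow> 'a mpoly" where
  "Const c = Poly_Mapping.single 0 c"

definition eval :: "'a::comm_ring_1 mpoly \<Rightarrow> (nat \<Rightarrow> 'a) \<Rightarrow> 'a" where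
  "eval p \<xi> = (\<Sum>m\<in>Poly_Mapping.keys p. Poly_Mapping.lookup p m * (\<Prod>i\<in>Poly_Mapping.keys m. \<xi> i ^ Poly_Mapping.lookup m i))"

definition pderiv_var :: "nat \<Rightarrow> 'a::comm_ring_1 mpoly \<Rightarrow> 'a mpoly" where
  "pderiv_var i p = Abs_poly_mapping
     (\<lambda>m. of_nat (Poly_Mapping.lookup m i + 1) * Poly_Mapping.lookup p (m + Poly_Mapping.single i 1))"

definition points :: "nat \<Rightarrow> (nat \<Rightarrow> 'a::zero) set" where
  "points n = {\<xi>. \<forall>i\<ge>n. \<xi> i = 0}"

definition lin_indep :: "nat \<Rightarrow> 'b set \<Rightarrow> ('b \<Rightarrow> nat \<Rightarrow> 'a::field) \<Rightarrow> bool" where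
  "lin_indep n J v \<longleftrightarrow>
     (\<forall>c. (\<forall>i<n. (\<Sum>j\<in>J. c j * v j i) = 0) \<longrightarrow> (\<forall>j\<in>J. c j = 0))"

definition mat_rank :: "nat \<Rightarrow> (nat \<Rightarrow> nat \<Rightarrow> 'a::field) \<Rightarrow> nat" where
  "mat_rank n M = Max {card J | J. J \<subseteq> {..<n} \<and> lin_indep n J (\<lambda>j i. M i j)}"

definition poisson_bracket ::
  "nat \<Rightarrow> ('a::field mpoly \<Rightarrow> 'a mpoly \<Rightarrow> 'a mpoly) \<Rightarrow> bool" where
  "poisson_bracket n B \<longleftrightarrow>
     (\<forall>f\<in>polyA n. \<forall>g\<in>polyA n. B f g \<in> polyA n) \<and>
     (\<forall>f\<in>polyA n. \<forall>g\<in>polyA n. \<forall>h\<in>polyA n. B (f + g) h = B f h + B g h) \<and>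
     (\<forall>c. \<forall>f\<in>polyA n. \<forall>g\<in>polyA n. B (Const c * f) g = Const c * B f g) \<and>
     (\<forall>f\<in>polyA n. \<forall>g\<in>polyA n. B f g = - B g f) \<and>
     (\<forall>f\<in>polyA n. \<forall>g\<in>polyA n. \<forall>h\<in>polyA n.
        B f (B g h) + B g (B h f) + B h (B f g) = 0) \<and>
     (\<forall>f\<in>polyA n. \<forall>g\<in>polyA n. \<forall>h\<in>polyA n. B f (g * h) = B f g * h + g * B f h)"

definition rk_pi :: "nat \<Rightarrow> ('a::field mpoly \<Rightarrow> 'a mpoly \<Rightarrow> 'a mpoly) \<Rightarrow> (nat \<Rightarrow> 'a) \<Rightarrow> nat" where
  "rk_pi n B \<xi> = mat_rank n (\<lambda>i j. eval (B (Var i) (Var j)) \<xi>)"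

definition max_rk :: "nat \<Rightarrow> ('a::field mpoly \<Rightarrow> 'a mpoly \<Rightarrow> 'a mpoly) \<Rightarrow> nat" where
  "max_rk n B = Max (rk_pi n B ` points n)"

definition poisson_index :: "nat \<Rightarrow> ('a::field mpoly \<Rightarrow> 'a mpoly \<Rightarrow> 'a mpoly) \<Rightarrow> nat" where
  "poisson_index n B = n - max_rk n B"

definition sing_pi :: "nat \<Rightarrow> ('a::field mpoly \<Rightarrow> 'a mpoly \<Rightarrow> 'a mpoly) \<Rightarrow> (nat \<Rightarrow> 'a) set" where
  "sing_pi n B = {\<xi>\<in>points n. rk_pi n B \<xi> < n - poisson_index n B}"

definition poisson_centre :: "nat \<Rightarrow> ('a::field mpoly \<Rightarrow> 'a mpoly \<Rightarrow> 'a mpoly) \<Rightarrow> 'a mpoly set" where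
  "poisson_centre n B = {f\<in>polyA n. \<forall>g\<in>polyA n. B f g = 0}"

definition zariski_closed :: "nat \<Rightarrow> (nat \<Rightarrow> 'a::field) set \<Rightarrow> bool" where
  "zariski_closed n X \<longleftrightarrow>
     (\<exists>F\<subseteq>polyA n. X = {\<xi>\<in>points n. \<forall>f\<in>F. eval f \<xi> = 0})"

definition irreducible_closed :: "nat \<Rightarrow> (nat \<Rightarrow> 'a::field) set \<Rightarrow> bool" where
  "irreducible_closed n Z \<longleftrightarrow> zariski_closed n Z \<and> Z \<noteq> {} \<and>
     (\<forall>Y1 Y2. zariski_closed n Y1 \<longrightarrow> zariski_closed n Y2 \<longrightarrow> Z \<subseteq> Y1 \<union> Y2 \<longrightarrow>
        Z \<subseteq> Y1 \<or> Z \<subseteq> Y2)"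

definition dim_ge :: "nat \<Rightarrow> nat \<Rightarrow> (nat \<Rightarrow> 'a::field) set \<Rightarrow> bool" where
  "dim_ge n k X \<longleftrightarrow> (\<exists>Z::nat \<Rightarrow> (nat \<Rightarrow> 'a) set.
     (\<forall>i\<le>k. irreducible_closed n (Z i)) \<and> (\<forall>i<k. Z i \<subset> Z (Suc i)) \<and> Z k \<subseteq> X)"

text \<open>codim X >= 2 in A^n, i.e. dim X <= n - 2 (the empty set has codimension infinity).\<close>
definition codim_ge2 :: "nat \<Rightarrow> (nat \<Rightarrow> 'a::field) set \<Rightarrow> bool" where
  "codim_ge2 n X \<longleftrightarrow> \<not> dim_ge n (n - 1) X"

definition jacobian_locus :: "nat \<Rightarrow> nat \<Rightarrow> (nat \<Rightarrow> 'a::field mpoly) \<Rightarrow> (nat \<Rightarrow> 'a) set" where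
  "jacobian_locus n m g =
     {\<xi>\<in>points n. \<not> lin_indep n {..<m} (\<lambda>k i. eval (pderiv_var i (g k)) \<xi>)}"

definition admissible ::
  "nat \<Rightarrow> ('a::field mpoly \<Rightarrow> 'a mpoly \<Rightarrow> 'a mpoly) \<Rightarrow> nat \<Rightarrow> (nat \<Rightarrow> 'a mpoly) \<Rightarrow> bool" where
  "admissible n B l Q \<longleftrightarrow>
     (\<forall>k<l. Q k \<in> poisson_centre n B) \<and> l = poisson_index n B \<and>
     codim_ge2 n (jacobian_locus n l Q)"

definition quasi_regular :: "nat \<Rightarrow> ('a::field mpoly \<Rightarrow> 'a mpoly \<Rightarrow> 'a mpoly) \<Rightarrow> bool" where
  "quasi_regular n B \<longleftrightarrow>
     (\<exists>Q. admissible n B (poisson_index n B) Q) \<and> codim_ge2 n (sing_pi n B)"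

text \<open>Both an element of the exterior algebra of W (multivectors) and of Omega
  (differential forms) are represented by their coefficient function on finite
  subsets S of {..<n}: D = sum_S D(S) d_(s1) ^ ... ^ d_(sk) with s1 < ... < sk, and
  likewise with dx_(s1) ^ ... ^ dx_(sk).  Coefficients at sets not contained in
  {..<n} are zero.\<close>

type_synonym 'a mvec = "nat set \<Rightarrow> 'a mpoly"

definition wsign :: "nat set \<Rightarrow> nat set \<Rightarrow> 'a::comm_ring_1" where
  "wsign S T = (-1) ^ card {(s, t). s \<in> S \<and> t \<in> T \<and> t < s}"

definition wedge :: "nat \<Rightarrow> 'a::comm_ring_1 mvec \<Rightarrow> 'a mvec \<Rightarrow> 'a mvec" where
  "wedge n a b = (\<lambda>U. if U \<subseteq> {..<n} then
      (\<Sum>S\<in>Pow U. wsign S (U - S) * a S * b (U - S)) else 0)"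

definition wunit :: "'a::comm_ring_1 mvec" where
  "wunit = (\<lambda>U. if U = {} then 1 else 0)"

definition wbasis :: "nat set \<Rightarrow> 'a::comm_ring_1 mvec" where
  "wbasis S = (\<lambda>U. if U = S then 1 else 0)"

definition wpow :: "nat \<Rightarrow> 'a::comm_ring_1 mvec \<Rightarrow> nat \<Rightarrow> 'a mvec" where
  "wpow n a k = (wedge n a ^^ k) wunit"

definition pi_bivector :: "nat \<Rightarrow> ('a::comm_ring_1 mpoly \<Rightarrow> 'a mpoly \<Rightarrow> 'a mpoly) \<Rightarrow> 'a mvec" where
  "pi_bivector n B = (\<lambda>U. if \<exists>i j. i < j \<and> j < n \<and> U = {i, j}
                          then B (Var (Min U)) (Var (Max U)) else 0)"

definition dform :: "nat \<Rightarrow> 'a::comm_ring_1 mpoly \<Rightarrow> 'a mvec" where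
  "dform n f = (\<lambda>U. if \<exists>i<n. U = {i} then pderiv_var (the_elem U) f else 0)"

primrec dwedge :: "nat \<Rightarrow> (nat \<Rightarrow> 'a::comm_ring_1 mpoly) \<Rightarrow> nat \<Rightarrow> 'a mvec" where
  "dwedge n Q 0 = wunit"
| "dwedge n Q (Suc k) = wedge n (dwedge n Q k) (dform n (Q k))"

text \<open>The pairing of Omega with the exterior algebra of W:
  <dx_S, d_T> = delta_(S,T) (determinant pairing in the sorted bases).\<close>
definition pairing :: "nat \<Rightarrow> 'a::comm_ring_1 mvec \<Rightarrow> 'a mvec \<Rightarrow> 'a mpoly" where
  "pairing n \<eta> D = (\<Sum>S\<in>Pow {..<n}. \<eta> S * D S)"

text \<open>j_omega: the coefficients of j_omega(D) are determined by
  <dx_S, j_omega(D)> = <dx_S ^ omega, D>.\<close>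
definition j_op :: "nat \<Rightarrow> 'a::comm_ring_1 mvec \<Rightarrow> 'a mvec \<Rightarrow> 'a mvec" where
  "j_op n \<omega> D = (\<lambda>S. if S \<subseteq> {..<n} then pairing n (wedge n (wbasis S) \<omega>) D else 0)"

definition top_vec :: "nat \<Rightarrow> 'a::comm_ring_1 mvec" where
  "top_vec n = wbasis {..<n}"

end

theory Submission
  imports Defs
begin

text \<open>Evaluated at a point, a power of \<open>\<pi>\<close> is annihilated by contraction with every \<open>dQ\<^sub>i\<close>, because the
  \<open>Q\<^sub>i\<close> are central, and a multivector of degree \<open>n - l\<close> annihilated by \<open>l\<close> independent covectors is a
  multiple of their contraction with the top multivector. So the coefficients of \<open>\<pi>\<^sup>k\<close> and of
  \<open>j\<^sub>\<omega>(\<partial>\<^sub>1 \<and> \<dots> \<and> \<partial>\<^sub>n)\<close> are proportional at each point. The common zeros of either family lie in a set of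
  codimension at least two, namely in the singular locus of \<open>\<pi>\<close>, respectively in the Jacobian locus.
  If the ratio varied in a coordinate direction, then the generic line in that direction would contain
  a common zero of one of the families, so one of the two zero sets would have dimension \<open>n - 1\<close>.\<close>

subsection \<open>Evaluation of polynomials\<close>

text \<open>Pointwise proportionality only yields a rational ratio. Excluding a nonconstant ratio
  usually takes unique factorization in n variables and the dimension of hypersurfaces. Here
  divisibility is only used in one variable, on coordinate lines, where algebraic closedness turns
  the absence of a common zero into divisibility. Codimension is defined by chains of irreducible
  closed sets, so a large supply of bad lines has to be converted into an explicit chain;
  \<open>big\<close> and the descending chain condition serve this purpose. Characteristic 0 enters
  through the infinity of the field and through the factor m + 1 that appears when the power of
  exponent m + 1 of the bivector is contracted. Evenness of the generic rank is a result, not an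
  input. The exponent starts as half of the rank rounded up, and the power with this exponent is
  nonzero wherever the rank is maximal. Since l independent covectors annihilate it, its degree is
  at most n - l, so nothing was rounded. The constant is the ratio of one pair of coefficients at
  one point where both are nonzero.\<close>

definition mon_val :: "(nat \<Rightarrow>\<^sub>0 nat) \<Rightarrow> (nat \<Rightarrow> 'a::comm_ring_1) \<Rightarrow> 'a" where
  "mon_val m \<xi> = (\<Prod>i\<in>Poly_Mapping.keys m. \<xi> i ^ Poly_Mapping.lookup m i)"

lemma mon_val_superset:
  assumes "finite A" "Poly_Mapping.keys m \<subseteq> A"
  shows "mon_val m \<xi> = (\<Prod>i\<in>A. \<xi> i ^ Poly_Mapping.lookup m i)"
  unfolding mon_val_def using assms
  by (intro prod.mono_neutral_left) (auto simp: in_keys_iff)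

lemma mon_val_add: "mon_val (m + m') \<xi> = mon_val m \<xi> * mon_val m' \<xi>"
proof -
  let ?A = "Poly_Mapping.keys m \<union> Poly_Mapping.keys m'"
  have "mon_val (m + m') \<xi> = (\<Prod>i\<in>?A. \<xi> i ^ Poly_Mapping.lookup (m + m') i)"
    by (rule mon_val_superset) (simp_all add: keys_add)
  also have "\<dots> = (\<Prod>i\<in>?A. \<xi> i ^ Poly_Mapping.lookup m i) * (\<Prod>i\<in>?A. \<xi> i ^ Poly_Mapping.lookup m' i)"
    by (simp add: lookup_add power_add prod.distrib)
  also have "\<dots> = mon_val m \<xi> * mon_val m' \<xi>"
    by (simp add: mon_val_superset[of ?A])
  finally show ?thesis .
qed

lemma mon_val_0 [simp]: "mon_val 0 \<xi> = 1"
  by (simp add: mon_val_def)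

text \<open>Summing over any finite superset of the support lets two polynomials share one index
  set, which makes additivity a termwise computation.\<close>

lemma eval_superset:
  assumes "finite A" "Poly_Mapping.keys p \<subseteq> A"
  shows "eval p \<xi> = (\<Sum>m\<in>A. Poly_Mapping.lookup p m * mon_val m \<xi>)"
  unfolding eval_def mon_val_def[symmetric] using assms
  by (intro sum.mono_neutral_left) (auto simp: in_keys_iff)

lemma eval_zero [simp]: "eval 0 \<xi> = 0"
  by (simp add: eval_def)

lemma eval_add [simp]: "eval (p + q) \<xi> = eval p \<xi> + eval q \<xi>"
proof -
  let ?A = "Poly_Mapping.keys p \<union> Poly_Mapping.keys q"
  have "eval (p + q) \<xi> = (\<Sum>m\<in>?A. Poly_Mapping.lookup (p + q) m * mon_val m \<xi>)"
    by (rule eval_superset) (simp_all add: keys_add)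
  also have "\<dots> = (\<Sum>m\<in>?A. Poly_Mapping.lookup p m * mon_val m \<xi>) + (\<Sum>m\<in>?A. Poly_Mapping.lookup q m * mon_val m \<xi>)"
    by (simp add: lookup_add sum.distrib algebra_simps)
  also have "\<dots> = eval p \<xi> + eval q \<xi>"
    by (simp add: eval_superset[of ?A])
  finally show ?thesis .
qed

lemma eval_sum [simp]: "eval (sum f A) \<xi> = (\<Sum>a\<in>A. eval (f a) \<xi>)"
  by (induction A rule: infinite_finite_induct) auto

lemma eval_single: "eval (Poly_Mapping.single m c) \<xi> = c * mon_val m \<xi>"
  by (cases "c = 0") (simp_all add: eval_def mon_val_def)

lemma eval_Const [simp]: "eval (Const c) \<xi> = c"
  by (simp add: Const_def eval_single)

lemma Const_1 [simp]: "Const 1 = 1"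
  by (simp add: Const_def)

lemma eval_one [simp]: "eval 1 \<xi> = 1"
  using eval_Const[of 1 \<xi>] by simp

lemma eval_Var [simp]: "eval (Var i) \<xi> = \<xi> i"
  by (simp add: Var_def eval_single mon_val_def)

lemma mpoly_sum_single:
  "p = (\<Sum>m\<in>Poly_Mapping.keys p. Poly_Mapping.single m (Poly_Mapping.lookup p m))"
  by (rule poly_mapping_eqI)
    (auto simp: lookup_sum lookup_single when_def in_keys_iff)

lemma eval_mult [simp]: "eval (p * q) \<xi> = eval p \<xi> * eval q \<xi>"
proof -
  have "p * q = (\<Sum>m\<in>Poly_Mapping.keys p. Poly_Mapping.single m (Poly_Mapping.lookup p m)) *
      (\<Sum>m\<in>Poly_Mapping.keys q. Poly_Mapping.single m (Poly_Mapping.lookup q m))"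
    using mpoly_sum_single by metis
  also have "eval \<dots> \<xi> = (\<Sum>m\<in>Poly_Mapping.keys p. \<Sum>m'\<in>Poly_Mapping.keys q.
      (Poly_Mapping.lookup p m * mon_val m \<xi>) * (Poly_Mapping.lookup q m' * mon_val m' \<xi>))"
    by (simp add: sum_product mult_single eval_single mon_val_add algebra_simps)
  also have "\<dots> = eval p \<xi> * eval q \<xi>"
    by (simp add: sum_product eval_def mon_val_def)
  finally show ?thesis .
qed

lemma eval_uminus [simp]: "eval (- p) \<xi> = - eval p \<xi>"
  using eval_add[of p "-p" \<xi>] by (simp add: eq_neg_iff_add_eq_0 add.commute)

lemma eval_diff [simp]: "eval (p - q) \<xi> = eval p \<xi> - eval q \<xi>"
  using eval_add[of p "-q" \<xi>] by simp

lemma eval_power [simp]: "eval (p ^ k) \<xi> = eval p \<xi> ^ k"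
  by (induction k) auto

text \<open>Restriction to a polynomial curve is the bridge to one variable: all root counting and
  divisibility below happens on lines.\<close>

lemma eval_along_curve:
  fixes p :: "'a::comm_ring_1 mpoly" and q :: "nat \<Rightarrow> 'a poly"
  shows "\<exists>r. \<forall>t. eval p (\<lambda>i. poly (q i) t) = poly r t"
proof
  show "\<forall>t. eval p (\<lambda>i. poly (q i) t) = poly (\<Sum>m\<in>Poly_Mapping.keys p.
      [:Poly_Mapping.lookup p m:] * (\<Prod>i\<in>Poly_Mapping.keys m. q i ^ Poly_Mapping.lookup m i)) t"
    by (simp add: eval_def poly_sum poly_prod)
qed

lemma eval_along_coordinate:
  fixes p :: "'a::comm_ring_1 mpoly"
  shows "\<exists>r. \<forall>t. eval p (\<xi>(j := t)) = poly r t"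
proof -
  have "(\<lambda>i. poly (if i = j then [:0, 1:] else [:\<xi> i:]) t) = \<xi>(j := t)" for t
    by auto
  then show ?thesis
    using eval_along_curve[of p "\<lambda>i. if i = j then [:0, 1:] else [:\<xi> i:]"] by simp
qed

lemma eval_along_line:
  fixes p :: "'a::comm_ring_1 mpoly"
  shows "\<exists>r. \<forall>t. eval p (\<lambda>i. \<xi> i + t * (\<eta> i - \<xi> i)) = poly r t"
  using eval_along_curve[of p "\<lambda>i. [:\<xi> i, \<eta> i - \<xi> i:]"] by simp

subsection \<open>The polynomial algebra\<close>

lemma polyA_0 [simp]: "0 \<in> polyA n"
  by (simp add: polyA_def)

lemma polyA_single:
  "Poly_Mapping.keys m \<subseteq> {..<n} \<Longrightarrow> Poly_Mapping.single m c \<in> polyA n"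
  by (auto simp: polyA_def)

lemma polyA_Const [simp]: "Const c \<in> polyA n"
  by (simp add: Const_def polyA_single)

lemma polyA_1 [simp]: "1 \<in> polyA n"
  using polyA_Const[of 1 n] by simp

lemma polyA_Var [simp]: "i < n \<Longrightarrow> Var i \<in> polyA n"
  by (simp add: Var_def polyA_single)

lemma polyA_add: "p \<in> polyA n \<Longrightarrow> q \<in> polyA n \<Longrightarrow> p + q \<in> polyA n"
  using keys_add[of p q] unfolding polyA_def by blast

lemma polyA_mult: "p \<in> polyA n \<Longrightarrow> q \<in> polyA n \<Longrightarrow> p * q \<in> polyA n"
proof -
  assume pq: "p \<in> polyA n" "q \<in> polyA n"
  have "Poly_Mapping.keys m \<subseteq> {..<n}" if m: "m \<in> Poly_Mapping.keys (p * q)" for m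
  proof -
    obtain a b where ab: "a \<in> Poly_Mapping.keys p" "b \<in> Poly_Mapping.keys q" "m = a + b"
      using keys_mult[of p q] m by blast
    then have "Poly_Mapping.keys a \<subseteq> {..<n}" "Poly_Mapping.keys b \<subseteq> {..<n}"
      using pq unfolding polyA_def by blast+
    then show ?thesis using keys_add[of a b] ab by blast
  qed
  then show ?thesis unfolding polyA_def by blast
qed

lemma polyA_uminus: "p \<in> polyA n \<Longrightarrow> - p \<in> polyA n"
  by (simp add: polyA_def in_keys_iff)

lemma polyA_diff: "p \<in> polyA n \<Longrightarrow> q \<in> polyA n \<Longrightarrow> p - q \<in> polyA n"
  using polyA_add[of p n "-q"] polyA_uminus[of q n] by simp

lemma polyA_sum: "(\<And>a. a \<in> A \<Longrightarrow> f a \<in> polyA n) \<Longrightarrow> sum f A \<in> polyA n"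
  by (induction A rule: infinite_finite_induct) (auto intro: polyA_add)

lemma polyA_power: "p \<in> polyA n \<Longrightarrow> p ^ k \<in> polyA n"
  by (induction k) (auto intro: polyA_mult)

text \<open>Induction on the number of variables. The index set and the exponent function
  \<open>e\<close> are abstract because the induction step keeps only the indices with one given
  exponent of the last variable, and compares these on the first n variables.\<close>

lemma monomials_independent:
  fixes c :: "'b \<Rightarrow> 'a::{field_char_0}" and e :: "'b \<Rightarrow> nat \<Rightarrow> nat"
  assumes "finite A"
    and "\<And>\<xi>. \<xi> \<in> points n \<Longrightarrow> (\<Sum>m\<in>A. c m * (\<Prod>i<n. \<xi> i ^ e m i)) = 0"
    and "\<And>m m'. m \<in> A \<Longrightarrow> m' \<in> A \<Longrightarrow> (\<And>i. i < n \<Longrightarrow> e m i = e m' i) \<Longrightarrow> m = m'"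
    and "m \<in> A"
  shows "c m = 0"
  using assms
proof (induction n arbitrary: A m)
  case 0
  then have "A = {m}" by blast
  moreover have "(\<lambda>_. 0) \<in> (points 0 :: (nat \<Rightarrow> 'a) set)"
    by (simp add: points_def)
  ultimately show ?case using 0(2)[of "\<lambda>_. 0"] by simp
next
  case (Suc n)
  let ?k = "e m n"
  show ?case
  proof (rule Suc.IH[of "{m'\<in>A. e m' n = ?k}"])
    fix \<xi> :: "nat \<Rightarrow> 'a" assume \<xi>: "\<xi> \<in> points n"
    \<comment> \<open>The sum regarded as a polynomial in the last coordinate. It vanishes
      identically, so its coefficient at \<open>?k\<close> is a relation in n variables.\<close>
    define r where "r = (\<Sum>m'\<in>A. monom (c m' * (\<Prod>i<n. \<xi> i ^ e m' i)) (e m' n))"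
    have "poly r t = 0" for t
    proof -
      have "\<xi>(n := t) \<in> points (Suc n)" using \<xi> by (auto simp: points_def)
      from Suc.prems(2)[OF this] show ?thesis
        by (simp add: r_def poly_sum poly_monom mult.assoc)
    qed
    then have "r = 0"
      using poly_eq_poly_eq_iff[of r 0] by (auto simp: fun_eq_iff)
    then have "coeff r ?k = 0" by simp
    then have "(\<Sum>m'\<in>A. if e m' n = ?k then c m' * (\<Prod>i<n. \<xi> i ^ e m' i) else 0) = 0"
      by (simp add: r_def coeff_sum)
    then show "(\<Sum>m'\<in>{m'\<in>A. e m' n = ?k}. c m' * (\<Prod>i<n. \<xi> i ^ e m' i)) = 0"
      using Suc.prems(1) by (simp add: sum.inter_filter)
  next
    fix m1 m2 assume *: "m1 \<in> {m'\<in>A. e m' n = ?k}" "m2 \<in> {m'\<in>A. e m' n = ?k}"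
      and "\<And>i. i < n \<Longrightarrow> e m1 i = e m2 i"
    then have "e m1 i = e m2 i" if "i < Suc n" for i
      using that by (cases "i = n") auto
    then show "m1 = m2" using Suc.prems(3) * by blast
  qed (use Suc.prems in auto)
qed

lemma polyA_eval_eq_0:
  fixes p :: "'a::{field_char_0} mpoly"
  assumes "p \<in> polyA n" and "\<And>\<xi>. \<xi> \<in> points n \<Longrightarrow> eval p \<xi> = 0"
  shows "p = 0"
proof -
  let ?K = "Poly_Mapping.keys p"
  have sub: "Poly_Mapping.keys m \<subseteq> {..<n}" if "m \<in> ?K" for m
    using assms(1) that by (auto simp: polyA_def)
  have "Poly_Mapping.lookup p m = 0" if "m \<in> ?K" for m
  proof (rule monomials_independent[where A = ?K and e = Poly_Mapping.lookup and n = n])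
    fix \<xi> :: "nat \<Rightarrow> 'a" assume \<xi>: "\<xi> \<in> points n"
    have "(\<Sum>m\<in>?K. Poly_Mapping.lookup p m * (\<Prod>i<n. \<xi> i ^ Poly_Mapping.lookup m i)) = eval p \<xi>"
      unfolding eval_superset[OF finite_keys order.refl]
      by (intro sum.cong refl) (simp add: mon_val_superset[of "{..<n}"] sub)
    then show "(\<Sum>m\<in>?K. Poly_Mapping.lookup p m * (\<Prod>i<n. \<xi> i ^ Poly_Mapping.lookup m i)) = 0"
      using assms(2)[OF \<xi>] by simp
  next
    fix m m' assume "m \<in> ?K" "m' \<in> ?K" and eq: "\<And>i. i < n \<Longrightarrow> Poly_Mapping.lookup m i = Poly_Mapping.lookup m' i"
    then show "m = m'"
      using sub[of m] sub[of m'] by (intro poly_mapping_eqI) (metis in_keys_iff lessThan_iff subsetD)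
  qed (use that in auto)
  then show ?thesis by (intro poly_mapping_eqI) (auto simp: in_keys_iff)
qed

text \<open>On the line from \<xi> to \<eta> each polynomial has finitely many zeros, and the field
  is infinite. Staying on this line preserves the coordinates in which the two points agree.\<close>

lemma common_nonzero_point:
  fixes p q :: "'a::{field_char_0} mpoly"
  assumes "\<xi> \<in> points n" "eval p \<xi> \<noteq> 0" "\<eta> \<in> points n" "eval q \<eta> \<noteq> 0"
  obtains \<zeta> where "\<zeta> \<in> points n" "eval p \<zeta> \<noteq> 0" "eval q \<zeta> \<noteq> 0"
    "\<And>i. \<xi> i = \<eta> i \<Longrightarrow> \<zeta> i = \<xi> i"
proof -
  let ?l = "\<lambda>t i. \<xi> i + t * (\<eta> i - \<xi> i)"
  obtain r where r: "\<And>t. eval p (?l t) = poly r t"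
    using eval_along_line[of p \<xi> \<eta>] by blast
  obtain s where s: "\<And>t. eval q (?l t) = poly s t"
    using eval_along_line[of q \<xi> \<eta>] by blast
  have "r \<noteq> 0" using r[of 0] assms by auto
  moreover have "s \<noteq> 0" using s[of 1] assms by auto
  ultimately have "finite ({t. poly r t = 0} \<union> {t. poly s t = 0})"
    by (auto intro: poly_roots_finite)
  then obtain t where "t \<notin> {t. poly r t = 0} \<union> {t. poly s t = 0}"
    using ex_new_if_finite infinite_UNIV_char_0 by blast
  then show ?thesis
    using assms by (intro that[of "?l t"]) (auto simp: r s points_def)
qed

subsection \<open>The descending chain condition for Zariski closed sets\<close>

lemma nondecreasing_subseq:
  fixes s :: "nat \<Rightarrow> nat"
  shows "\<exists>g :: nat \<Rightarrow> nat. strict_mono g \<and> mono (\<lambda>i. s (g i))"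
proof -
  obtain f where f: "strict_mono f" "monoseq (\<lambda>i. s (f i))"
    using seq_monosub[of s] by blast
  consider "incseq (\<lambda>i. s (f i))" | "decseq (\<lambda>i. s (f i))"
    using f(2) monoseq_iff by blast
  then show ?thesis
  proof cases
    case 1
    then show ?thesis using f(1) by blast
  next
    case 2
    \<comment> \<open>At an index where a decreasing sequence takes its least value, it becomes
      constant.\<close>
    obtain N where N: "\<And>i. s (f N) \<le> s (f i)"
      using ex_has_least_nat[of "\<lambda>_. True" _ "\<lambda>i. s (f i)"] by blast
    have "s (f (i + N)) = s (f N)" for i
      using N[of "i + N"] decseqD[OF 2, of N "i + N"] by simp
    then have "mono (\<lambda>i. s (f (i + N)))" by (simp add: mono_def)
    moreover have "strict_mono (\<lambda>i. f (i + N))"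
      using f(1) by (simp add: strict_mono_def)
    ultimately show ?thesis by (intro exI[of _ "\<lambda>i. f (i + N)"] conjI)
  qed
qed

lemma nondecreasing_subseq_coords:
  fixes s :: "nat \<Rightarrow> nat \<Rightarrow> nat"
  shows "\<exists>g :: nat \<Rightarrow> nat. strict_mono g \<and> (\<forall>k<n. mono (\<lambda>i. s (g i) k))"
proof (induction n)
  case 0
  show ?case by (rule exI[of _ id]) (simp add: strict_mono_def)
next
  case (Suc n)
  then obtain g :: "nat \<Rightarrow> nat" where g: "strict_mono g" "\<And>k. k < n \<Longrightarrow> mono (\<lambda>i. s (g i) k)" by blast
  obtain f :: "nat \<Rightarrow> nat" where f: "strict_mono f" "mono (\<lambda>i. s (g (f i)) n)"
    using nondecreasing_subseq[of "\<lambda>i. s (g i) n"] by blast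
  have "mono (\<lambda>i. s (g (f i)) k)" if "k < Suc n" for k
  proof (cases "k = n")
    case False
    then have "mono (\<lambda>i. s (g i) k)" using g(2) that by simp
    then show ?thesis using strict_mono_mono[OF f(1)] by (simp add: mono_def)
  qed (use f in simp)
  moreover have "strict_mono (\<lambda>i. g (f i))"
    using f(1) g(1) by (simp add: strict_mono_def)
  ultimately show ?case by (intro exI[of _ "\<lambda>i. g (f i)"]) blast
qed

text \<open>Two terms of a subsequence that is monotone in all n coordinates will do. Divisibility
  is expressed by a cofactor \<open>d\<close>, since the order on exponent vectors is lexicographic
  and not componentwise.\<close>

lemma dickson:
  fixes s :: "nat \<Rightarrow> (nat \<Rightarrow>\<^sub>0 nat)"
  assumes "\<And>i. Poly_Mapping.keys (s i) \<subseteq> {..<n}"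
  obtains i j d where "i < j" "s j = s i + d" "Poly_Mapping.keys d \<subseteq> {..<n}"
proof -
  obtain g :: "nat \<Rightarrow> nat" where g: "strict_mono g" "\<And>k. k < n \<Longrightarrow> mono (\<lambda>i. Poly_Mapping.lookup (s (g i)) k)"
    using nondecreasing_subseq_coords[of n "\<lambda>i. Poly_Mapping.lookup (s i)"] by blast
  have zero: "Poly_Mapping.lookup (s i) k = 0" if "k \<ge> n" for i k
    using assms[of i] that by (meson in_keys_iff lessThan_iff linorder_not_less subsetD)
  have le: "Poly_Mapping.lookup (s (g 0)) k \<le> Poly_Mapping.lookup (s (g 1)) k" for k
    using g(2)[of k] zero by (cases "k < n") (auto simp: mono_def)
  show ?thesis
  proof (rule that[of "g 0" "g 1" "s (g 1) - s (g 0)"])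
    show "g 0 < g 1" using g(1) by (simp add: strict_mono_def)
    show "s (g 1) = s (g 0) + (s (g 1) - s (g 0))"
      by (rule poly_mapping_eqI) (use le in \<open>simp add: lookup_add lookup_minus del: One_nat_def\<close>)
    show "Poly_Mapping.keys (s (g 1) - s (g 0)) \<subseteq> {..<n}"
    proof
      fix k assume "k \<in> Poly_Mapping.keys (s (g 1) - s (g 0))"
      then have "Poly_Mapping.lookup (s (g 1)) k \<noteq> 0" by (auto simp: in_keys_iff lookup_minus)
      then show "k \<in> {..<n}" using zero[of k "g 1"] by (meson lessThan_iff linorder_not_less)
    qed
  qed
qed

section \<open>The lexicographic monomial order and chains of ideals\<close>

lemma monomial_nonneg: "0 \<le> (d :: nat \<Rightarrow>\<^sub>0 nat)"
proof (cases "d = 0")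
  case False
  then obtain k where k: "Poly_Mapping.lookup d k \<noteq> 0"
    by (metis lookup_zero poly_mapping_eqI)
  define k0 where "k0 = (LEAST k. Poly_Mapping.lookup d k \<noteq> 0)"
  have "Poly_Mapping.lookup d k0 \<noteq> 0" unfolding k0_def using k by (rule LeastI)
  moreover have "Poly_Mapping.lookup d k' = 0" if "k' < k0" for k'
    using that not_less_Least unfolding k0_def by blast
  ultimately have "0 < d"
    unfolding less_poly_mapping.rep_eq less_fun_def by (intro exI[of _ k0]) simp
  then show ?thesis by simp
qed simp

text \<open>In an infinite descent Dickson's lemma finds a later term that is a multiple of an
  earlier one, hence not smaller. The bound on the variables matters: with infinitely many
  variables, x_0 > x_1 > x_2 > ... descends forever.\<close>

lemma wf_monomials:
  "wf {(a, b :: nat \<Rightarrow>\<^sub>0 nat). a < b \<and> Poly_Mapping.keys a \<subseteq> {..<n} \<and> Poly_Mapping.keys b \<subseteq> {..<n}}"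
  unfolding wf_iff_no_infinite_down_chain
proof
  assume "\<exists>f. \<forall>i. (f (Suc i), f i) \<in> {(a, b :: nat \<Rightarrow>\<^sub>0 nat). a < b \<and> Poly_Mapping.keys a \<subseteq> {..<n} \<and> Poly_Mapping.keys b \<subseteq> {..<n}}"
  then obtain f :: "nat \<Rightarrow> (nat \<Rightarrow>\<^sub>0 nat)"
    where *: "\<forall>i. (f (Suc i), f i) \<in> {(a, b). a < b \<and> Poly_Mapping.keys a \<subseteq> {..<n} \<and> Poly_Mapping.keys b \<subseteq> {..<n}}" ..
  have f: "f (Suc i) < f i" "Poly_Mapping.keys (f i) \<subseteq> {..<n}" for i
    using spec[OF *, of i] by simp_all
  obtain i j d where ij: "i < j" "f j = f i + d" by (rule dickson[of f n, OF f(2)])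
  have "f j < f i" using ij(1)
    by (induction rule: less_Suc_induct) (auto intro: f(1) less_trans)
  moreover have "f i \<le> f j" using ij(2) monomial_nonneg[of d] by (simp add: add_increasing2)
  ultimately show False by simp
qed

lemma single_mult_eq:
  "Poly_Mapping.single d c * f =
    (\<Sum>m\<in>Poly_Mapping.keys f. Poly_Mapping.single (d + m) (c * Poly_Mapping.lookup f m))"
  for f :: "'a::comm_ring_1 mpoly"
  by (subst mpoly_sum_single[of f]) (simp add: sum_distrib_left mult_single)

lemma lookup_single_mult:
  "Poly_Mapping.lookup (Poly_Mapping.single d c * f) (d + m) = c * Poly_Mapping.lookup f m"
  for f :: "'a::comm_ring_1 mpoly"
  unfolding single_mult_eq by (auto simp: lookup_sum lookup_single when_def in_keys_iff)

text \<open>One division step: \<open>c\<close> is the quotient of the leading coefficients, so the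
  leading terms cancel, and compatibility of the order with multiplication keeps all other monomials
  below.\<close>

lemma leading_monomial_reduction:
  fixes f g :: "'a::field mpoly"
  assumes "f \<noteq> 0" "g \<noteq> 0"
    and "Max (Poly_Mapping.keys g) = Max (Poly_Mapping.keys f) + d"
  obtains c where "g - Poly_Mapping.single d c * f = 0 \<or>
    Max (Poly_Mapping.keys (g - Poly_Mapping.single d c * f)) < Max (Poly_Mapping.keys g)"
proof -
  let ?F = "Max (Poly_Mapping.keys f)" and ?G = "Max (Poly_Mapping.keys g)"
  have ne: "Poly_Mapping.keys f \<noteq> {}" "Poly_Mapping.keys g \<noteq> {}"
    using assms(1,2) by (metis in_keys_iff empty_iff lookup_zero poly_mapping_eqI)+
  then have "?F \<in> Poly_Mapping.keys f" by simp
  then have f0: "Poly_Mapping.lookup f ?F \<noteq> 0" by (simp add: in_keys_iff)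
  define c where "c = Poly_Mapping.lookup g ?G / Poly_Mapping.lookup f ?F"
  let ?h = "g - Poly_Mapping.single d c * f"
  have "Poly_Mapping.lookup ?h ?G = 0"
    using f0 by (simp add: assms(3) add.commute[of _ d] lookup_minus lookup_single_mult c_def)
  then have notin: "?G \<notin> Poly_Mapping.keys ?h" by (simp add: in_keys_iff)
  have le: "k \<le> ?G" if k: "k \<in> Poly_Mapping.keys ?h" for k
  proof -
    have "k \<in> Poly_Mapping.keys g \<or> k \<in> Poly_Mapping.keys (Poly_Mapping.single d c * f)"
      using k by (auto simp: in_keys_iff lookup_minus)
    then show ?thesis
    proof
      assume "k \<in> Poly_Mapping.keys (Poly_Mapping.single d c * f)"
      then obtain a b where "k = a + b" "a \<in> Poly_Mapping.keys (Poly_Mapping.single d c)" "b \<in> Poly_Mapping.keys f"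
        using keys_mult by blast
      then have "k = b + d" "b \<le> ?F" by (auto split: if_splits simp: add.commute)
      then show ?thesis using assms(3) by (simp add: add_right_mono)
    qed simp
  qed
  have "Max (Poly_Mapping.keys ?h) < ?G" if "?h \<noteq> 0"
  proof -
    have "Poly_Mapping.keys ?h \<noteq> {}"
      using that by (metis in_keys_iff empty_iff lookup_zero poly_mapping_eqI)
    then have "Max (Poly_Mapping.keys ?h) \<in> Poly_Mapping.keys ?h" by simp
    then show ?thesis using le notin by (metis order_le_imp_less_or_eq)
  qed
  then show ?thesis using that by blast
qed

text \<open>Hilbert's basis theorem by minimal counterexample: in each step of an ascending chain
  choose a new element with least leading monomial; Dickson's lemma reduces one of them by an
  earlier one, to a smaller leading monomial.\<close>

lemma ideal_acc:
  fixes I :: "nat \<Rightarrow> 'a::field mpoly set"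
  assumes sub: "\<And>i. I i \<subseteq> polyA n" and zero: "\<And>i. 0 \<in> I i"
    and diff: "\<And>i f g. f \<in> I i \<Longrightarrow> g \<in> I i \<Longrightarrow> f - g \<in> I i"
    and mult: "\<And>i f g. f \<in> I i \<Longrightarrow> g \<in> polyA n \<Longrightarrow> g * f \<in> I i"
    and asc: "\<And>i. I i \<subset> I (Suc i)"
  shows False
proof -
  let ?lm = "\<lambda>f :: 'a mpoly. Max (Poly_Mapping.keys f)"
  let ?M = "{m. Poly_Mapping.keys m \<subseteq> {..<n}}"
  have nz: "f \<noteq> 0" if "f \<in> I (Suc i) - I i" for f i using that zero by blast
  have lm: "?lm f \<in> ?M" if "f \<in> I (Suc i) - I i" for f i
  proof -
    have "Poly_Mapping.keys f \<noteq> {}"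
      using nz[OF that] by (metis in_keys_iff empty_iff lookup_zero poly_mapping_eqI)
    then have "?lm f \<in> Poly_Mapping.keys f" by simp
    moreover have "f \<in> polyA n" using that sub by blast
    ultimately show ?thesis unfolding polyA_def by blast
  qed
  have "\<exists>f. f \<in> I (Suc i) - I i \<and> (\<forall>g \<in> I (Suc i) - I i. \<not> ?lm g < ?lm f)" for i
  proof -
    obtain f0 where "f0 \<in> I (Suc i) - I i" using asc by blast
    then have "?lm f0 \<in> ?lm ` (I (Suc i) - I i)" by blast
    then obtain z where z: "z \<in> ?lm ` (I (Suc i) - I i)"
        "\<And>y. (y, z) \<in> {(a, b). a < b \<and> Poly_Mapping.keys a \<subseteq> {..<n} \<and> Poly_Mapping.keys b \<subseteq> {..<n}}
            \<Longrightarrow> y \<notin> ?lm ` (I (Suc i) - I i)" by (rule wfE_min[OF wf_monomials[of n]]) blast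
    then obtain f where f: "f \<in> I (Suc i) - I i" "z = ?lm f" by blast
    have "\<not> ?lm g < ?lm f" if g: "g \<in> I (Suc i) - I i" for g
      using z(2)[of "?lm g"] lm[OF g] lm[OF f(1)] f(2) g by auto
    then show ?thesis using f(1) by blast
  qed
  then obtain f where f: "\<And>i. f i \<in> I (Suc i) - I i"
    and min: "\<And>i g. g \<in> I (Suc i) - I i \<Longrightarrow> \<not> ?lm g < ?lm (f i)" by metis
  have "Poly_Mapping.keys (?lm (f i)) \<subseteq> {..<n}" for i using lm[OF f[of i]] by blast
  then obtain i j d where ij: "i < j" "?lm (f j) = ?lm (f i) + d" "Poly_Mapping.keys d \<subseteq> {..<n}"
    using dickson[of "\<lambda>i. ?lm (f i)" n] by blast
  obtain c where c: "f j - Poly_Mapping.single d c * f i = 0 \<or>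
      ?lm (f j - Poly_Mapping.single d c * f i) < ?lm (f j)"
    by (rule leading_monomial_reduction[OF nz[OF f] nz[OF f] ij(2)])
  let ?h = "f j - Poly_Mapping.single d c * f i"
  have mono: "I a \<subseteq> I b" if "a \<le> b" for a b
    using psubset_imp_subset[OF asc] that by (rule lift_Suc_mono_le)
  have "Poly_Mapping.single d c * f i \<in> I j"
    using f[of i] mono[of "Suc i" j] ij(1) ij(3) by (auto intro!: mult polyA_single)
  then have sf: "Poly_Mapping.single d c * f i \<in> I j" "Poly_Mapping.single d c * f i \<in> I (Suc j)"
    using mono[of j "Suc j"] by auto
  have "?h \<in> I (Suc j)" using diff f[of j] sf by blast
  moreover have "?h \<notin> I j"
  proof
    assume "?h \<in> I j"
    \<comment> \<open>The sum of \<open>?h\<close> and the subtracted multiple, written with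
      differences; it equals \<open>f j\<close>, which was chosen outside
      \<open>I j\<close>.\<close>
    then have "?h - (0 - Poly_Mapping.single d c * f i) \<in> I j"
      using diff[OF _ diff[OF zero sf(1)]] by blast
    then show False using f[of j] by simp
  qed
  ultimately have "?h \<in> I (Suc j) - I j" by blast
  with min[OF this] nz[OF this] c show False by blast
qed

text \<open>A strictly descending chain of closed sets would give a strictly ascending chain of
  vanishing ideals, against \<open>ideal_acc\<close>.\<close>

lemma zariski_closed_dcc:
  fixes C :: "(nat \<Rightarrow> 'a::field) set set"
  assumes "X \<in> C" and "\<And>X. X \<in> C \<Longrightarrow> zariski_closed n X"
  shows "\<exists>Z\<in>C. \<forall>Y\<in>C. \<not> Y \<subset> Z"
proof -
  have "wf {(Y, Z :: (nat \<Rightarrow> 'a) set). Y \<subset> Z \<and> zariski_closed n Y \<and> zariski_closed n Z}"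
    unfolding wf_iff_no_infinite_down_chain
  proof
    assume "\<exists>f. \<forall>i. (f (Suc i), f i) \<in> {(Y, Z :: (nat \<Rightarrow> 'a) set). Y \<subset> Z \<and> zariski_closed n Y \<and> zariski_closed n Z}"
    then obtain V :: "nat \<Rightarrow> (nat \<Rightarrow> 'a) set"
      where *: "\<forall>i. (V (Suc i), V i) \<in> {(Y, Z). Y \<subset> Z \<and> zariski_closed n Y \<and> zariski_closed n Z}" ..
    have V: "V (Suc i) \<subset> V i" "zariski_closed n (V i)" for i
      using spec[OF *, of i] by simp_all
    define I where "I = (\<lambda>i. {f \<in> polyA n. \<forall>\<xi>\<in>V i. eval f \<xi> = 0})"
    \<comment> \<open>A closed set is recovered from its ideal, so strictness of the inclusions
      survives the passage to ideals.\<close>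
    have V_eq: "V i = {\<xi>\<in>points n. \<forall>f\<in>I i. eval f \<xi> = 0}" for i
    proof -
      obtain F where F: "F \<subseteq> polyA n" "V i = {\<xi>\<in>points n. \<forall>f\<in>F. eval f \<xi> = 0}"
        using V(2)[of i] unfolding zariski_closed_def by blast
      then have "F \<subseteq> I i" unfolding I_def by blast
      then show ?thesis using F(2) unfolding I_def by blast
    qed
    show False
    proof (rule ideal_acc[of I n])
      show "I i \<subset> I (Suc i)" for i
      proof -
        have "V (Suc i) \<subseteq> V i" using V(1)[of i] by (rule psubset_imp_subset)
        then have "I i \<subseteq> I (Suc i)" unfolding I_def by blast
        moreover have "I i \<noteq> I (Suc i)"
        proof
          assume "I i = I (Suc i)"
          then have "V i = V (Suc i)" using V_eq[of i] V_eq[of "Suc i"] by simp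
          then show False using V(1)[of i] by simp
        qed
        ultimately show ?thesis by blast
      qed
    qed (auto simp: I_def intro: polyA_diff polyA_mult)
  qed
  from mp[OF spec[OF spec[OF iffD1[OF wf_eq_minimal this], of C], of X] assms(1)]
  obtain Z where "Z \<in> C"
    and Z: "\<forall>Y. (Y, Z) \<in> {(Y, Z). Y \<subset> Z \<and> zariski_closed n Y \<and> zariski_closed n Z} \<longrightarrow> Y \<notin> C"
    ..
  then have "\<not> Y \<subset> Z" if "Y \<in> C" for Y
    using spec[OF Z, of Y] that assms(2)[OF that] assms(2)[OF \<open>Z \<in> C\<close>] by simp
  with \<open>Z \<in> C\<close> show ?thesis by blast
qed

subsection \<open>Large sets of points\<close>

text \<open>\<open>big is Y\<close> says that the projection of \<open>Y\<close> to the coordinates \<open>is\<close> is large, in a sense that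
  is inherited by one part of any partition into two parts.  For closed \<open>Y\<close> it bounds the dimension
  from below, and it replaces the dimension theory of hypersurfaces.\<close>

fun big :: "nat list \<Rightarrow> (nat \<Rightarrow> 'a) set \<Rightarrow> bool" where
  "big [] Y \<longleftrightarrow> Y \<noteq> {}"
| "big (i # is) Y \<longleftrightarrow> infinite {a. big is {\<xi>\<in>Y. \<xi> i = a}}"

lemma big_nonempty: "big is Y \<Longrightarrow> Y \<noteq> {}"
proof (induction "is" arbitrary: Y)
  case (Cons i "is")
  then have "{a. big is {\<xi>\<in>Y. \<xi> i = a}} \<noteq> {}" by (intro infinite_imp_nonempty) simp
  then obtain a where "big is {\<xi>\<in>Y. \<xi> i = a}" by blast
  then show ?case using Cons.IH by blast
qed simp

text \<open>If the good values for a union form an infinite set, then so do those for one of the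
  parts, as two finite sets cannot cover it.\<close>

lemma big_Un: "big is (Y \<union> Y') \<Longrightarrow> big is Y \<or> big is Y'"
proof (induction "is" arbitrary: Y Y')
  case (Cons i "is")
  have "{a. big is {\<xi>\<in>Y \<union> Y'. \<xi> i = a}} \<subseteq> {a. big is {\<xi>\<in>Y. \<xi> i = a}} \<union> {a. big is {\<xi>\<in>Y'. \<xi> i = a}}"
  proof
    fix a assume "a \<in> {a. big is {\<xi>\<in>Y \<union> Y'. \<xi> i = a}}"
    moreover have "{\<xi>\<in>Y \<union> Y'. \<xi> i = a} = {\<xi>\<in>Y. \<xi> i = a} \<union> {\<xi>\<in>Y'. \<xi> i = a}" by blast
    ultimately show "a \<in> {a. big is {\<xi>\<in>Y. \<xi> i = a}} \<union> {a. big is {\<xi>\<in>Y'. \<xi> i = a}}"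
      using Cons.IH[of "{\<xi>\<in>Y. \<xi> i = a}" "{\<xi>\<in>Y'. \<xi> i = a}"] by simp
  qed
  then show ?case using Cons.prems by (auto dest: finite_subset)
qed auto

lemma zariski_closed_Int:
  assumes "zariski_closed n X" "zariski_closed n Y"
  shows "zariski_closed n (X \<inter> Y)"
proof -
  obtain F where F: "F \<subseteq> polyA n" "X = {\<xi>\<in>points n. \<forall>f\<in>F. eval f \<xi> = 0}"
    using assms(1) unfolding zariski_closed_def by blast
  obtain G where G: "G \<subseteq> polyA n" "Y = {\<xi>\<in>points n. \<forall>f\<in>G. eval f \<xi> = 0}"
    using assms(2) unfolding zariski_closed_def by blast
  show ?thesis unfolding zariski_closed_def
    by (rule exI[of _ "F \<union> G"]) (use F G in blast)
qed

lemma zariski_closed_slice: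
  assumes "zariski_closed n X" "i < n"
  shows "zariski_closed n {\<xi>\<in>X. \<xi> i = a}"
proof -
  obtain F where F: "F \<subseteq> polyA n" "X = {\<xi>\<in>points n. \<forall>f\<in>F. eval f \<xi> = 0}"
    using assms(1) unfolding zariski_closed_def by blast
  show ?thesis unfolding zariski_closed_def
    by (rule exI[of _ "insert (Var i - Const a) F"])
      (use F assms(2) in \<open>auto intro: polyA_diff\<close>)
qed

lemma zariski_closed_zeros:
  "(\<And>s. p s \<in> polyA n) \<Longrightarrow> zariski_closed n {\<xi>\<in>points n. \<forall>s. eval (p s) \<xi> = 0}"
  unfolding zariski_closed_def by (rule exI[of _ "range p"]) auto

text \<open>A minimal large closed subset is irreducible, by \<open>big_Un\<close>.\<close>

lemma big_irreducible:
  fixes X :: "(nat \<Rightarrow> 'a::field) set"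
  assumes "zariski_closed n X" "big is X"
  obtains Z where "Z \<subseteq> X" "irreducible_closed n Z" "big is Z"
proof -
  define C where "C = {Z. Z \<subseteq> X \<and> zariski_closed n Z \<and> big is Z}"
  have "X \<in> C" using assms by (simp add: C_def)
  moreover have "zariski_closed n Z" if "Z \<in> C" for Z
    using that by (simp add: C_def)
  ultimately have "\<exists>Z\<in>C. \<forall>Y\<in>C. \<not> Y \<subset> Z"
    by (rule zariski_closed_dcc)
  then obtain Z where Z: "Z \<in> C" and min: "\<forall>Y\<in>C. \<not> Y \<subset> Z" by blast
  \<comment> \<open>By minimality of \<open>Z\<close>, a large closed part of \<open>Z\<close> is
    all of \<open>Z\<close>.\<close>
  have sub: "Z \<subseteq> Y" if "zariski_closed n Y" "big is (Z \<inter> Y)" for Y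
  proof -
    have "Z \<inter> Y \<in> C"
      using Z that zariski_closed_Int[of n Z Y] by (auto simp: C_def)
    then show ?thesis using min by blast
  qed
  have "Z \<subseteq> Y1 \<or> Z \<subseteq> Y2"
    if "zariski_closed n Y1" "zariski_closed n Y2" "Z \<subseteq> Y1 \<union> Y2" for Y1 Y2
  proof -
    have "(Z \<inter> Y1) \<union> (Z \<inter> Y2) = Z" using that(3) by blast
    then have "big is (Z \<inter> Y1) \<or> big is (Z \<inter> Y2)"
      using big_Un[of "is" "Z \<inter> Y1" "Z \<inter> Y2"] Z by (simp add: C_def)
    then show ?thesis using sub that by blast
  qed
  then have "irreducible_closed n Z"
    using Z big_nonempty[of "is" Z] unfolding irreducible_closed_def C_def by blast
  then show ?thesis using Z by (intro that[of Z]) (simp_all add: C_def)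
qed

text \<open>Each coordinate contributes one link of the chain: an irreducible large closed subset
  \<open>Z\<close> is put on top of a chain inside one of its large slices.\<close>

lemma big_dim_ge:
  fixes X :: "(nat \<Rightarrow> 'a::field) set"
  assumes "zariski_closed n X" "big is X" "set is \<subseteq> {..<n}"
  shows "dim_ge n (length is) X"
  using assms
proof (induction "is" arbitrary: X)
  case Nil
  obtain Z where "Z \<subseteq> X" "irreducible_closed n Z"
    by (rule big_irreducible[OF Nil(1,2)])
  then show ?case by (auto simp: dim_ge_def)
next
  case (Cons i "is")
  obtain Z where Z: "Z \<subseteq> X" "irreducible_closed n Z" "big (i # is) Z"
    by (rule big_irreducible[OF Cons.prems(1,2)])
  have "infinite {a. big is {\<xi>\<in>Z. \<xi> i = a}}" using Z(3) by simp
  then obtain a where a: "big is {\<xi>\<in>Z. \<xi> i = a}"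
    using infinite_imp_nonempty[of "{a. big is {\<xi>\<in>Z. \<xi> i = a}}"] by auto
  \<comment> \<open>A second value \<open>b\<close> with a nonempty slice shows that the slice at
    \<open>a\<close> is a proper subset of \<open>Z\<close>.\<close>
  have "infinite ({a. big is {\<xi>\<in>Z. \<xi> i = a}} - {a})" using Z(3) by simp
  then obtain b where b: "b \<noteq> a" "big is {\<xi>\<in>Z. \<xi> i = b}"
    using infinite_imp_nonempty[of "{a. big is {\<xi>\<in>Z. \<xi> i = a}} - {a}"] by auto
  obtain \<eta> where \<eta>: "\<eta> \<in> Z" "\<eta> i = b" using big_nonempty[OF b(2)] by blast
  have "zariski_closed n {\<xi>\<in>Z. \<xi> i = a}"
    using Z(2) Cons.prems(3) by (intro zariski_closed_slice) (auto simp: irreducible_closed_def)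
  then have "dim_ge n (length is) {\<xi>\<in>Z. \<xi> i = a}"
    by (rule Cons.IH) (use a Cons.prems(3) in auto)
  then obtain C where C: "\<forall>k\<le>length is. irreducible_closed n (C k)"
    "\<forall>k<length is. C k \<subset> C (Suc k)" "C (length is) \<subseteq> {\<xi>\<in>Z. \<xi> i = a}"
    unfolding dim_ge_def by (elim exE conjE)
  have top: "C (length is) \<subset> Z" using C(3) \<eta> b(1) by blast
  let ?C = "\<lambda>k. if k \<le> length is then C k else Z"
  show ?case unfolding dim_ge_def
  proof (intro exI[of _ ?C] conjI allI impI)
    fix k assume "k < length (i # is)"
    then consider "k < length is" | "k = length is" by fastforce
    then show "?C k \<subset> ?C (Suc k)" by cases (use C(2) top in auto)
  qed (use C Z in auto)
qed

lemma dim_ge_mono: "dim_ge n k X \<Longrightarrow> X \<subseteq> Y \<Longrightarrow> dim_ge n k Y"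
  unfolding dim_ge_def by (elim exE conjE, intro exI conjI, assumption+, rule subset_trans)

lemma codim_ge2_not_big:
  assumes "codim_ge2 n Y" "X \<subseteq> Y" "zariski_closed n X" "set is \<subseteq> {..<n}" "length is = n - 1"
  shows "\<not> big is X"
  using big_dim_ge[of n X "is"] assms dim_ge_mono unfolding codim_ge2_def by metis

text \<open>Outside the zeros of \<open>G\<close> the coordinates in the list can be prescribed one
  after another, each with finitely many exceptions. Adjusting the remaining coordinate
  \<open>j\<close> to land in \<open>Y\<close> does not disturb them.\<close>

lemma big_if_meets_lines:
  fixes G :: "'a::field_char_0 mpoly"
  assumes "distinct is" "j \<notin> set is" "eval G \<zeta> \<noteq> 0"
    and "\<And>\<xi>. (\<And>i. i \<notin> set is \<Longrightarrow> \<xi> i = \<zeta> i) \<Longrightarrow> eval G \<xi> \<noteq> 0 \<Longrightarrow> \<exists>t. \<xi>(j := t) \<in> Y"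
  shows "big is Y"
  using assms
proof (induction "is" arbitrary: \<zeta> Y)
  case Nil
  then show ?case by force
next
  case (Cons i "is")
  obtain r where r: "\<And>t. eval G (\<zeta>(i := t)) = poly r t"
    using eval_along_coordinate[of G \<zeta> i] by metis
  have "r \<noteq> 0" using r[of "\<zeta> i"] Cons.prems(3) by auto
  then have "infinite (- {t. poly r t = 0})"
    using poly_roots_finite infinite_UNIV_char_0 by (metis Compl_eq_Diff_UNIV Diff_infinite_finite)
  moreover have "- {t. poly r t = 0} \<subseteq> {a. big is {\<xi>\<in>Y. \<xi> i = a}}"
  proof
    fix a assume "a \<in> - {t. poly r t = 0}"
    then have nz: "eval G (\<zeta>(i := a)) \<noteq> 0" using r by simp
    have "big is {\<xi>\<in>Y. \<xi> i = a}"
    proof (rule Cons.IH[OF _ _ nz])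
      fix \<xi> assume \<xi>: "\<And>k. k \<notin> set is \<Longrightarrow> \<xi> k = (\<zeta>(i := a)) k" "eval G \<xi> \<noteq> 0"
      have "\<xi> k = \<zeta> k" if "k \<notin> set (i # is)" for k using \<xi>(1)[of k] that by auto
      then have "\<exists>t. \<xi>(j := t) \<in> Y" using \<xi>(2) by (rule Cons.prems(4))
      then obtain t where "\<xi>(j := t) \<in> Y" by (elim exE)
      moreover have "(\<xi>(j := t)) i = a" using \<xi>(1)[of i] Cons.prems(1,2) by auto
      ultimately show "\<exists>t. \<xi>(j := t) \<in> {\<xi>\<in>Y. \<xi> i = a}" by blast
    qed (use Cons.prems in auto)
    then show "a \<in> {a. big is {\<xi>\<in>Y. \<xi> i = a}}" by simp
  qed
  ultimately show ?case using finite_subset by auto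
qed

lemma big_points:
  assumes "distinct is" "set is \<subseteq> {..<n}"
  shows "big is (points n :: (nat \<Rightarrow> 'a::field_char_0) set)"
\<comment> \<open>Coordinate n is a dummy direction: all points vanish there, so t = 0 always
  works.\<close>
proof (rule big_if_meets_lines[where G = 1 and j = n and \<zeta> = "\<lambda>_. 0"])
  fix \<xi> :: "nat \<Rightarrow> 'a" assume "\<And>i. i \<notin> set is \<Longrightarrow> \<xi> i = 0"
  then have "\<xi>(n := 0) \<in> points n" using assms(2) by (force simp: points_def)
  then show "\<exists>t. \<xi>(n := t) \<in> points n" ..
qed (use assms in auto)

subsection \<open>Proportional families without common divisorial zeros\<close>

text \<open>The hypothesis says that \<open>p\<close> divides \<open>q\<close> in the local ring at
  every \<open>a\<close>. A root of \<open>p\<close> is then a root of \<open>q\<close>, and the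
  common linear factor is cancelled.\<close>

lemma dvd_if_locally_dvd:
  fixes p q :: "'a::alg_closed_field poly"
  assumes "p \<noteq> 0" "\<And>a. \<exists>u v. poly u a \<noteq> 0 \<and> p * v = u * q"
  shows "p dvd q"
  using assms
proof (induction "degree p" arbitrary: p q)
  case 0
  then have "is_unit p" by (simp add: is_unit_iff_degree)
  then show ?case by (rule unit_imp_dvd)
next
  case (Suc d)
  obtain a where a: "poly p a = 0"
    using alg_closed_imp_poly_has_root[of p] Suc(2) by auto
  then obtain p' where p': "p = [:- a, 1:] * p'" by (auto simp: poly_eq_0_iff_dvd)
  obtain u v where uv: "poly u a \<noteq> 0" "p * v = u * q" using Suc.prems(2) by blast
  have "poly (u * q) a = 0" unfolding uv(2)[symmetric] using a by simp
  then have "poly q a = 0" using uv(1) by simp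
  then obtain q' where q': "q = [:- a, 1:] * q'" by (auto simp: poly_eq_0_iff_dvd)
  have "p' dvd q'"
  proof (rule Suc.hyps(1))
    have "p' \<noteq> 0" using p' Suc.prems(1) by auto
    then have "degree p = Suc (degree p')" unfolding p' by (subst degree_mult_eq) auto
    then show "d = degree p'" using Suc.hyps(2) by simp
    show "p' \<noteq> 0" by fact
    fix b
    obtain u v where uv: "poly u b \<noteq> 0" "p * v = u * q" using Suc.prems(2) by blast
    have "[:- a, 1:] * (p' * v) = [:- a, 1:] * (u * q')"
      using uv(2) unfolding p' q' by (simp only: mult_ac)
    then have "p' * v = u * q'" by (subst (asm) mult_left_cancel) auto
    then show "\<exists>u v. poly u b \<noteq> 0 \<and> p' * v = u * q'" using uv(1) by blast
  qed
  then show ?case unfolding p' q' by (rule mult_dvd_mono[OF dvd_refl])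
qed

text \<open>Near a point where \<open>P T\<close> does not vanish, \<open>W S\<close> is
  \<open>P S\<close> times \<open>W T\<close> over \<open>P T\<close>, which is the local
  divisibility needed.\<close>

lemma proportional_families_dvd:
  fixes P W :: "'i \<Rightarrow> 'a::alg_closed_field poly"
  assumes "\<And>S T. P S * W T = P T * W S" "\<And>a. \<exists>T. poly (P T) a \<noteq> 0"
  shows "P S dvd W S"
proof (cases "P S = 0")
  case True
  obtain T where "poly (P T) 0 \<noteq> 0" using assms(2) by blast
  then have "P T \<noteq> 0" by auto
  then have "W S = 0" using assms(1)[of S T] True by simp
  then show ?thesis by simp
next
  case False
  then show ?thesis
  proof (rule dvd_if_locally_dvd)
    fix a
    obtain T where "poly (P T) a \<noteq> 0" using assms(2) by blast
    then show "\<exists>u v. poly u a \<noteq> 0 \<and> P S * v = u * W S" using assms(1)[of S T] by blast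
  qed
qed

text \<open>Divisibility in both directions makes the quotient a unit of the polynomial ring in one
  variable, that is, a constant. The conclusion is cross-multiplied to cover zeros of
  \<open>P S\<close> and \<open>W S\<close>.\<close>

lemma proportional_families_line:
  fixes P W :: "'i \<Rightarrow> 'a::alg_closed_field poly"
  assumes "\<And>S T. P S * W T = P T * W S"
    and "\<And>a. \<exists>T. poly (P T) a \<noteq> 0" "\<And>a. \<exists>T. poly (W T) a \<noteq> 0"
  shows "poly (P S) s * poly (W S) t = poly (P S) t * poly (W S) s"
proof -
  have "P S dvd W S" by (rule proportional_families_dvd) fact+
  then obtain k where k: "W S = P S * k" by (elim dvdE)
  have "W S * P T = W T * P S" for S T using assms(1)[of T S] by (simp add: mult.commute)
  then have "W S dvd P S" using assms(3) by (rule proportional_families_dvd)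
  then obtain k' where k': "P S = W S * k'" by (elim dvdE)
  show ?thesis
  proof (cases "P S = 0")
    case False
    have "P S * (k * k') = P S * 1" using k k' by (metis mult.assoc mult.right_neutral)
    then have "k * k' = 1" using False mult_left_cancel by blast
    then have "is_unit k" by (metis dvd_triv_left)
    then obtain c where "k = [:c:]" by (auto simp: is_unit_poly_iff)
    then show ?thesis using k by simp
  qed (use k in simp)
qed

lemma eval_subst_coordinate:
  "\<exists>R. \<forall>\<xi>. eval R \<xi> = eval p (\<xi>(j := a))" for p :: "'a::comm_ring_1 mpoly"
proof
  let ?R = "\<Sum>m\<in>Poly_Mapping.keys p. Const (Poly_Mapping.lookup p m) *
      (\<Prod>i\<in>Poly_Mapping.keys m. (if i = j then Const a else Var i) ^ Poly_Mapping.lookup m i)"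
  show "\<forall>\<xi>. eval ?R \<xi> = eval p (\<xi>(j := a))"
  proof
    fix \<xi> :: "nat \<Rightarrow> 'a"
    have "eval (\<Prod>i\<in>K. (if i = j then Const a else Var i) ^ e i) \<xi> = (\<Prod>i\<in>K. (\<xi>(j := a)) i ^ e i)"
      for K and e :: "nat \<Rightarrow> nat"
      by (induction K rule: infinite_finite_induct) auto
    then show "eval ?R \<xi> = eval p (\<xi>(j := a))"
      by (simp add: eval_def[of p])
  qed
qed

text \<open>\<open>G\<close> measures the change of the ratio between a point and its shift to
  \<open>j\<close>-coordinate \<open>t\<close>. Where \<open>G\<close> is nonzero, the line in
  direction \<open>j\<close> must contain a common zero of one of the families. If this happened
  once, it would happen for a large set of lines in n - 1 parameters.\<close>

lemma proportional_families_direction: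
  fixes P W :: "'i \<Rightarrow> 'a::{alg_closed_field, field_char_0} mpoly"
  assumes PW: "\<And>\<xi> S T. \<xi> \<in> points n \<Longrightarrow> eval (P S) \<xi> * eval (W T) \<xi> = eval (P T) \<xi> * eval (W S) \<xi>"
    and A: "\<And>S. P S \<in> polyA n" "\<And>S. W S \<in> polyA n"
    and codim: "codim_ge2 n {\<xi>\<in>points n. \<forall>S. eval (P S) \<xi> = 0}"
      "codim_ge2 n {\<xi>\<in>points n. \<forall>S. eval (W S) \<xi> = 0}"
    and j: "j < n" and \<zeta>: "\<zeta> \<in> points n"
  shows "eval (P S) \<zeta> * eval (W S) (\<zeta>(j := t)) = eval (P S) (\<zeta>(j := t)) * eval (W S) \<zeta>"
proof (rule ccontr)
  assume neq: "\<not> ?thesis"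
  let ?XP = "{\<xi>\<in>points n. \<forall>S. eval (P S) \<xi> = 0}" and ?XW = "{\<xi>\<in>points n. \<forall>S. eval (W S) \<xi> = 0}"
  let ?is = "filter (\<lambda>i. i \<noteq> j) [0..<n]"
  have "length ?is = card (set ?is)" by (rule distinct_card[symmetric]) simp
  also have "set ?is = {..<n} - {j}" by auto
  finally have len: "length ?is = n - 1" using j by simp
  obtain Pt where Pt: "\<forall>\<xi>. eval Pt \<xi> = eval (P S) (\<xi>(j := t))" using eval_subst_coordinate by blast
  obtain Wt where Wt: "\<forall>\<xi>. eval Wt \<xi> = eval (W S) (\<xi>(j := t))" using eval_subst_coordinate by blast
  define G where "G = P S * Wt - Pt * W S"
  have G: "eval G \<xi> = eval (P S) \<xi> * eval (W S) (\<xi>(j := t)) - eval (P S) (\<xi>(j := t)) * eval (W S) \<xi>" for \<xi>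
    using Pt Wt by (simp add: G_def)
  have "big ?is (?XP \<union> ?XW)"
  proof (rule big_if_meets_lines)
    show "eval G \<zeta> \<noteq> 0" using neq by (simp add: G)
    fix \<xi> assume eq: "\<And>i. i \<notin> set ?is \<Longrightarrow> \<xi> i = \<zeta> i" and nz: "eval G \<xi> \<noteq> 0"
    have \<xi>: "\<xi> \<in> points n" using eq \<zeta> by (auto simp: points_def)
    then have line: "\<xi>(j := a) \<in> points n" for a using j by (auto simp: points_def)
    have "\<forall>T. \<exists>r. \<forall>a. eval (P T) (\<xi>(j := a)) = poly r a" using eval_along_coordinate by blast
    then obtain p where p: "\<forall>T. \<forall>a. eval (P T) (\<xi>(j := a)) = poly (p T) a" by (rule choice[THEN exE])
    have "\<forall>T. \<exists>r. \<forall>a. eval (W T) (\<xi>(j := a)) = poly r a" using eval_along_coordinate by blast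
    then obtain w where w: "\<forall>T. \<forall>a. eval (W T) (\<xi>(j := a)) = poly (w T) a" by (rule choice[THEN exE])
    have pw: "p T * w T' = p T' * w T" for T T'
    proof -
      have "poly (p T * w T') a = poly (p T' * w T) a" for a
        using PW[OF line, of T a T'] p w by simp
      then show ?thesis by (subst poly_eq_poly_eq_iff[symmetric]) (rule ext)
    qed
    show "\<exists>a. \<xi>(j := a) \<in> ?XP \<union> ?XW"
    proof (rule ccontr)
      assume "\<not> ?thesis"
      then have "\<xi>(j := a) \<notin> ?XP" "\<xi>(j := a) \<notin> ?XW" for a by auto
      then have ex: "\<exists>T. poly (p T) a \<noteq> 0" "\<exists>T. poly (w T) a \<noteq> 0" for a
        using line[of a] p w by auto
      have "poly (p S) (\<xi> j) * poly (w S) t = poly (p S) t * poly (w S) (\<xi> j)"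
        by (rule proportional_families_line[OF pw ex])
      moreover have "eval (P S) \<xi> = poly (p S) (\<xi> j)" "eval (W S) \<xi> = poly (w S) (\<xi> j)"
        using p w by (metis fun_upd_triv)+
      ultimately have "eval G \<xi> = 0" using p w by (simp add: G)
      then show False using nz by contradiction
    qed
  qed auto
  then have "big ?is ?XP \<or> big ?is ?XW" by (rule big_Un)
  moreover have "\<not> big ?is ?XP"
    by (rule codim_ge2_not_big[OF codim(1) order.refl]) (use A len in \<open>auto intro: zariski_closed_zeros\<close>)
  moreover have "\<not> big ?is ?XW"
    by (rule codim_ge2_not_big[OF codim(2) order.refl]) (use A len in \<open>auto intro: zariski_closed_zeros\<close>)
  ultimately show False by blast
qed

text \<open>The whole space is large in n - 1 coordinates, so it cannot be the common zero
  set.\<close>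

lemma codim_ge2_nonzero:
  fixes P :: "'i \<Rightarrow> 'a::field_char_0 mpoly"
  assumes "codim_ge2 n {\<xi>\<in>points n. \<forall>S. eval (P S) \<xi> = 0}" "\<And>S. P S \<in> polyA n"
  shows "\<exists>\<xi>\<in>points n. \<exists>S. eval (P S) \<xi> \<noteq> 0"
proof (rule ccontr)
  assume "\<not> ?thesis"
  then have eq: "{\<xi>\<in>points n. \<forall>S. eval (P S) \<xi> = 0} = points n" by blast
  have "\<not> big [0..<n - 1] {\<xi>\<in>points n. \<forall>S. eval (P S) \<xi> = 0}"
    by (rule codim_ge2_not_big[OF assms(1) order.refl]) (use assms(2) in \<open>auto intro: zariski_closed_zeros\<close>)
  moreover have "big [0..<n - 1] (points n :: (nat \<Rightarrow> 'a) set)"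
    by (rule big_points) auto
  ultimately show False using eq by simp
qed

text \<open>The constant is read off at one base point and carried to every other point by changing
  one coordinate at a time.\<close>

theorem proportional_families:
  fixes P W :: "'i \<Rightarrow> 'a::{alg_closed_field, field_char_0} mpoly"
  assumes PW: "\<And>\<xi> S T. \<xi> \<in> points n \<Longrightarrow> eval (P S) \<xi> * eval (W T) \<xi> = eval (P T) \<xi> * eval (W S) \<xi>"
    and A: "\<And>S. P S \<in> polyA n" "\<And>S. W S \<in> polyA n"
    and codim: "codim_ge2 n {\<xi>\<in>points n. \<forall>S. eval (P S) \<xi> = 0}"
      "codim_ge2 n {\<xi>\<in>points n. \<forall>S. eval (W S) \<xi> = 0}"
  shows "\<exists>c. c \<noteq> 0 \<and> (\<forall>S. P S = Const c * W S)"
proof -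
  obtain \<xi> S where \<xi>: "\<xi> \<in> points n" "eval (P S) \<xi> \<noteq> 0" using codim_ge2_nonzero[OF codim(1) A(1)] by blast
  obtain \<eta> T where \<eta>: "\<eta> \<in> points n" "eval (W T) \<eta> \<noteq> 0" using codim_ge2_nonzero[OF codim(2) A(2)] by blast
  obtain \<xi>0 where \<xi>0: "\<xi>0 \<in> points n" "eval (P S) \<xi>0 \<noteq> 0" "eval (W T) \<xi>0 \<noteq> 0"
    by (rule common_nonzero_point[OF \<xi> \<eta>])
  then have WS0: "eval (W S) \<xi>0 \<noteq> 0" using PW[of \<xi>0 S T] by auto
  define c where "c = eval (P S) \<xi>0 / eval (W S) \<xi>0"
  define E where "E = P S - Const c * W S"
  \<comment> \<open>Here \<open>k\<close> bounds the coordinates that may differ from those of the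
    base point \<open>\<xi>0\<close>.\<close>
  have E: "eval E \<xi> = 0" if "\<xi> \<in> points n" "\<And>i. i \<ge> k \<Longrightarrow> \<xi> i = \<xi>0 i" "k \<le> n" for \<xi> k
    using that
  proof (induction k arbitrary: \<xi>)
    case 0
    then have "\<xi> = \<xi>0" by auto
    then show ?case using WS0 by (simp add: E_def c_def)
  next
    case (Suc k)
    show ?case
    proof (rule ccontr)
      assume nz: "eval E \<xi> \<noteq> 0"
      \<comment> \<open>\<open>R\<close> is \<open>W S\<close> with coordinate \<open>k\<close>
        frozen at its base value. Constancy along direction \<open>k\<close> is informative only if
        this value is nonzero, so the point is first moved to one where both \<open>E\<close> and
        \<open>R\<close> are nonzero.\<close>
      obtain R where R: "\<forall>\<xi>. eval R \<xi> = eval (W S) (\<xi>(k := \<xi>0 k))" using eval_subst_coordinate by blast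
      have nz': "eval R \<xi>0 \<noteq> 0" using R WS0 by simp
      obtain \<zeta> where "\<zeta> \<in> points n" "eval E \<zeta> \<noteq> 0" "eval R \<zeta> \<noteq> 0"
        and eq: "\<And>i. \<xi> i = \<xi>0 i \<Longrightarrow> \<zeta> i = \<xi> i"
        by (rule common_nonzero_point[OF Suc.prems(1) nz \<xi>0(1) nz']) blast
      then have \<zeta>: "\<zeta> \<in> points n" "eval E \<zeta> \<noteq> 0" "eval (W S) (\<zeta>(k := \<xi>0 k)) \<noteq> 0"
        using R by simp_all
      have \<zeta>4: "\<zeta> i = \<xi>0 i" if "i \<ge> Suc k" for i using eq[of i] Suc.prems(2)[OF that] by simp
      have \<zeta>': "\<zeta>(k := \<xi>0 k) \<in> points n" using \<zeta>(1) Suc.prems(3) by (auto simp: points_def)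
      have "eval E (\<zeta>(k := \<xi>0 k)) = 0"
      proof (rule Suc.IH[OF \<zeta>'])
        show "(\<zeta>(k := \<xi>0 k)) i = \<xi>0 i" if "i \<ge> k" for i
          using \<zeta>4[of i] that by auto
      qed (use Suc.prems in auto)
      then have "eval (P S) (\<zeta>(k := \<xi>0 k)) = c * eval (W S) (\<zeta>(k := \<xi>0 k))" by (simp add: E_def)
      moreover have "eval (P S) \<zeta> * eval (W S) (\<zeta>(k := \<xi>0 k)) = eval (P S) (\<zeta>(k := \<xi>0 k)) * eval (W S) \<zeta>"
        by (rule proportional_families_direction[OF PW A codim]) (use Suc.prems \<zeta> in auto)
      ultimately have "(eval (P S) \<zeta> - c * eval (W S) \<zeta>) * eval (W S) (\<zeta>(k := \<xi>0 k)) = 0"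
        by (simp add: algebra_simps)
      then show False using \<zeta>(2,3) by (simp add: E_def)
    qed
  qed
  have "eval E \<xi> = 0" if "\<xi> \<in> points n" for \<xi>
    by (rule E[OF that, of n]) (use that \<xi>0(1) in \<open>auto simp: points_def\<close>)
  then have EPW: "eval (P S) \<xi> = c * eval (W S) \<xi>" if "\<xi> \<in> points n" for \<xi>
    using that by (simp add: E_def)
  have "P T = Const c * W T" for T
  proof -
    \<comment> \<open>The constant was found for the single index \<open>S\<close>; proportionality
      transfers it to \<open>T\<close> after multiplication by the nonzero polynomial
      \<open>W S\<close>.\<close>
    have "W S * (P T - Const c * W T) = 0"
    proof (rule polyA_eval_eq_0)
      show "W S * (P T - Const c * W T) \<in> polyA n"
        by (intro polyA_mult polyA_diff A polyA_Const)
      fix \<xi> :: "nat \<Rightarrow> 'a" assume "\<xi> \<in> points n"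
      then show "eval (W S * (P T - Const c * W T)) \<xi> = 0"
        using PW[of \<xi> S T] EPW[of \<xi>] by (auto simp: algebra_simps)
    qed
    moreover have "W S \<noteq> 0" using WS0 by auto
    ultimately show ?thesis by simp
  qed
  moreover have "c \<noteq> 0" using \<xi>0(2) WS0 by (simp add: c_def)
  ultimately show ?thesis by blast
qed

subsection \<open>Creation and annihilation operators\<close>

text \<open>On coefficient functions of multivectors, \<open>cre i\<close> is left multiplication by the basis vector
  with index \<open>i\<close> and \<open>ann i\<close> is contraction with the dual covector.\<close>

definition sg :: "nat \<Rightarrow> nat set \<Rightarrow> 'a::comm_ring_1" where
  "sg i S = (-1) ^ card {s\<in>S. s < i}"

definition cre :: "nat \<Rightarrow> (nat set \<Rightarrow> 'a::comm_ring_1) \<Rightarrow> nat set \<Rightarrow> 'a" where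
  "cre i D S = (if i \<in> S then sg i S * D (S - {i}) else 0)"

definition ann :: "nat \<Rightarrow> (nat set \<Rightarrow> 'a::comm_ring_1) \<Rightarrow> nat set \<Rightarrow> 'a" where
  "ann i D S = (if i \<in> S then 0 else sg i S * D (insert i S))"

definition cre_vec :: "nat \<Rightarrow> (nat \<Rightarrow> 'a::comm_ring_1) \<Rightarrow> (nat set \<Rightarrow> 'a) \<Rightarrow> nat set \<Rightarrow> 'a" where
  "cre_vec n u D S = (\<Sum>i<n. u i * cre i D S)"

definition ann_vec :: "nat \<Rightarrow> (nat \<Rightarrow> 'a::comm_ring_1) \<Rightarrow> (nat set \<Rightarrow> 'a) \<Rightarrow> nat set \<Rightarrow> 'a" where
  "ann_vec n v D S = (\<Sum>i<n. v i * ann i D S)"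

lemma sg_insert:
  assumes "i \<notin> S"
  shows "sg j (insert i S) = (if i < j then - sg j S else sg j S)"
proof (cases "i < j")
  case True
  then have "{s\<in>insert i S. s < j} = insert i {s\<in>S. s < j}" by auto
  moreover have "card (insert i {s\<in>S. s < j}) = Suc (card {s\<in>S. s < j})"
    using assms by (intro card_insert_disjoint) auto
  ultimately show ?thesis using True by (simp add: sg_def)
next
  case False
  then have "{s\<in>insert i S. s < j} = {s\<in>S. s < j}" by auto
  then show ?thesis using False by (simp add: sg_def)
qed

lemma sg_remove: "i \<in> S \<Longrightarrow> (sg j (S - {i}) :: 'a::comm_ring_1) = (if i < j then - sg j S else sg j S)"
  using sg_insert[of i "S - {i}" j, where 'a = 'a] by (auto simp: insert_absorb)

lemma sg_sq [simp]: "sg i S * sg i S = 1"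
  by (simp add: sg_def flip: power_mult_distrib)

lemma cre_cre: "cre i (cre j D) S = - cre j (cre i D) S"
proof (cases "i = j")
  case False
  have "S - {i} - {j} = S - {j} - {i}" by blast
  then show ?thesis using False by (auto simp: cre_def sg_remove)
qed (simp add: cre_def)

lemma ann_ann: "ann i (ann j D) S = - ann j (ann i D) S"
  by (cases "i = j") (auto simp: ann_def sg_insert insert_commute)

text \<open>The Clifford relation. For equal indices exactly one summand survives, according to
  whether i lies in S. For different indices the summands cancel, since moving the smaller index
  flips exactly one sign.\<close>

lemma ann_cre: "ann i (cre j D) S + cre j (ann i D) S = (if i = j then D S else 0)"
proof (cases "i = j")
  case True
  then show ?thesis
    by (auto simp: ann_def cre_def sg_insert sg_remove insert_absorb simp flip: mult.assoc)
next
  case False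
  then have "insert i S - {j} = insert i (S - {j})" by blast
  then show ?thesis using False by (auto simp: ann_def cre_def sg_insert sg_remove)
qed

lemma cre_sum: "cre i (\<lambda>S. \<Sum>x\<in>A. f x S) S = (\<Sum>x\<in>A. cre i (f x) S)"
  by (simp add: cre_def sum_distrib_left)

lemma ann_sum: "ann i (\<lambda>S. \<Sum>x\<in>A. f x S) S = (\<Sum>x\<in>A. ann i (f x) S)"
  by (simp add: ann_def sum_distrib_left)

lemma cre_scale: "cre i (\<lambda>S. c * D S) S = c * cre i D S"
  by (simp add: cre_def)

lemma ann_scale: "ann i (\<lambda>S. c * D S) S = c * ann i D S"
  by (simp add: ann_def)

lemma cre_diff: "cre i (\<lambda>S. D S - E S) S = cre i D S - cre i E S"
  by (simp add: cre_def algebra_simps)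

lemma cre_vec_scale: "cre_vec n u (\<lambda>S. c * D S) S = c * cre_vec n u D S"
  by (simp add: cre_vec_def cre_scale sum_distrib_left mult.left_commute)

lemma ann_vec_scale: "ann_vec n u (\<lambda>S. c * D S) S = c * ann_vec n u D S"
  by (simp add: ann_vec_def ann_scale sum_distrib_left mult.left_commute)

lemma cre_vec_zero [simp]: "cre_vec n u (\<lambda>S. 0) S = 0"
  using cre_vec_scale[of n u 0 "\<lambda>S. 0" S] by simp

lemma ann_vec_zero [simp]: "ann_vec n u (\<lambda>S. 0) S = 0"
  using ann_vec_scale[of n u 0 "\<lambda>S. 0" S] by simp

text \<open>Bilinear form of \<open>ann_cre\<close>. With pairing 1 it makes contraction and wedge
  inverse to each other on kernels; with pairing 0 the two operators anticommute.\<close>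

lemma ann_vec_cre_vec:
  "ann_vec n v (cre_vec n u D) S + cre_vec n u (ann_vec n v D) S = (\<Sum>i<n. v i * u i) * D S"
proof -
  have "ann_vec n v (cre_vec n u D) S = (\<Sum>i<n. \<Sum>j<n. v i * u j * ann i (cre j D) S)"
    unfolding ann_vec_def cre_vec_def[abs_def] ann_sum ann_scale by (simp add: sum_distrib_left mult.assoc)
  moreover have "cre_vec n u (ann_vec n v D) S = (\<Sum>j<n. \<Sum>i<n. v i * u j * cre j (ann i D) S)"
    unfolding cre_vec_def ann_vec_def[abs_def] cre_sum cre_scale by (simp add: sum_distrib_left mult_ac)
  then have "cre_vec n u (ann_vec n v D) S = (\<Sum>i<n. \<Sum>j<n. v i * u j * cre j (ann i D) S)"
    by (subst sum.swap)
  ultimately have "ann_vec n v (cre_vec n u D) S + cre_vec n u (ann_vec n v D) S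
      = (\<Sum>i<n. \<Sum>j<n. v i * u j * (ann i (cre j D) S + cre j (ann i D) S))"
    by (simp add: sum.distrib distrib_left)
  also have "\<dots> = (\<Sum>i<n. v i * u i) * D S"
    by (simp add: ann_cre sum_distrib_right if_distrib[of "\<lambda>x. _ * x"] cong: if_cong)
  finally show ?thesis .
qed

lemma ann_vec_cre:
  assumes "j < n"
  shows "ann_vec n v (cre j D) S = v j * D S - cre j (ann_vec n v D) S"
proof -
  have "cre_vec n (\<lambda>i. if i = j then 1 else 0) E = cre j E" for E :: "nat set \<Rightarrow> 'a"
    using assms by (auto simp: cre_vec_def if_distrib[of "\<lambda>x. x * _"] cong: if_cong)
  then show ?thesis
    using ann_vec_cre_vec[of n v "\<lambda>i. if i = j then 1 else 0" D S] assms
    by (simp add: eq_diff_eq if_distrib[of "\<lambda>x. _ * x"] cong: if_cong)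
qed

lemma ann_vec_ann_vec: "ann_vec n v (ann_vec n w D) S = - ann_vec n w (ann_vec n v D) S"
proof -
  have "ann_vec n v (ann_vec n w D) S = (\<Sum>i<n. \<Sum>j<n. v i * w j * ann i (ann j D) S)"
    unfolding ann_vec_def ann_vec_def[abs_def] ann_sum ann_scale by (simp add: sum_distrib_left mult.assoc)
  also have "\<dots> = (\<Sum>j<n. \<Sum>i<n. v i * w j * ann i (ann j D) S)" by (rule sum.swap)
  also have "\<dots> = - (\<Sum>j<n. \<Sum>i<n. w j * v i * ann j (ann i D) S)"
    by (subst ann_ann) (simp add: sum_negf mult_ac)
  also have "(\<Sum>j<n. \<Sum>i<n. w j * v i * ann j (ann i D) S) = ann_vec n w (ann_vec n v D) S"
    unfolding ann_vec_def ann_vec_def[abs_def] ann_sum ann_scale by (simp add: sum_distrib_left mult.assoc)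
  finally show ?thesis .
qed

text \<open>The degree is an integer so that subtracting from it does not truncate; negative degree
  then forces zero. The zero family has every degree.\<close>

definition of_degree :: "nat \<Rightarrow> int \<Rightarrow> (nat set \<Rightarrow> 'a::zero) \<Rightarrow> bool" where
  "of_degree n d D \<longleftrightarrow> (\<forall>S. D S \<noteq> 0 \<longrightarrow> S \<subseteq> {..<n} \<and> int (card S) = d)"

lemma of_degree_cre_vec:
  assumes "of_degree n d D"
  shows "of_degree n (d + 1) (cre_vec n u D)"
  unfolding of_degree_def
proof (intro allI impI)
  fix S assume "cre_vec n u D S \<noteq> 0"
  then have "\<exists>i<n. cre i D S \<noteq> 0" by (rule contrapos_np) (simp add: cre_vec_def)
  then obtain i where i: "i < n" "cre i D S \<noteq> 0" by blast
  then have iS: "i \<in> S" and "D (S - {i}) \<noteq> 0" by (auto simp: cre_def split: if_splits)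
  then have *: "S - {i} \<subseteq> {..<n}" "int (card (S - {i})) = d" using assms by (auto simp: of_degree_def)
  have sub: "S \<subseteq> {..<n}" using *(1) i(1) by auto
  then have "finite S" by (rule finite_subset) simp
  then have "card S = Suc (card (S - {i}))" using iS by (rule card_Suc_Diff1[symmetric])
  then show "S \<subseteq> {..<n} \<and> int (card S) = d + 1" using sub *(2) by simp
qed

lemma of_degree_ann_vec:
  assumes "of_degree n d D"
  shows "of_degree n (d - 1) (ann_vec n u D)"
  unfolding of_degree_def
proof (intro allI impI)
  fix S assume "ann_vec n u D S \<noteq> 0"
  then have "\<exists>i<n. ann i D S \<noteq> 0" by (rule contrapos_np) (simp add: ann_vec_def)
  then obtain i where i: "i < n" "ann i D S \<noteq> 0" by blast
  then have iS: "i \<notin> S" and "D (insert i S) \<noteq> 0" by (auto simp: ann_def split: if_splits)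
  then have *: "insert i S \<subseteq> {..<n}" "int (card (insert i S)) = d" using assms by (auto simp: of_degree_def)
  then have "finite S" using finite_subset[of "insert i S" "{..<n}"] by simp
  then show "S \<subseteq> {..<n} \<and> int (card S) = d - 1" using * iS by simp
qed

lemma of_degree_eq_0:
  assumes "of_degree n d D" "d < 0 \<or> d > int n"
  shows "D S = 0"
proof (rule ccontr)
  assume "D S \<noteq> 0"
  then have "S \<subseteq> {..<n}" "int (card S) = d" using assms(1) by (auto simp: of_degree_def)
  then show False using assms(2) card_mono[of "{..<n}" S] by auto
qed

text \<open>The counterpart of \<open>top_vec\<close> over an arbitrary ring, so that the same
  formulas apply to polynomial coefficients and to their values at a point.\<close>

definition top_coeff :: "nat \<Rightarrow> nat set \<Rightarrow> 'a::comm_ring_1" where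
  "top_coeff n S = (if S = {..<n} then 1 else 0)"

lemma of_degree_top:
  assumes "of_degree n (int n) D"
  shows "D S = D {..<n} * top_coeff n S"
proof (cases "D S = 0")
  case False
  then have "S \<subseteq> {..<n}" "card S = n" using assms by (auto simp: of_degree_def)
  then have "S = {..<n}" by (intro card_subset_eq) auto
  then show ?thesis by (simp add: top_coeff_def)
qed (auto simp: top_coeff_def)

text \<open>The covector of largest index is contracted last, matching the recursion of
  \<open>dwedge\<close>.\<close>

primrec ann_vecs :: "nat \<Rightarrow> (nat \<Rightarrow> nat \<Rightarrow> 'a::comm_ring_1) \<Rightarrow> nat \<Rightarrow> (nat set \<Rightarrow> 'a) \<Rightarrow> nat set \<Rightarrow> 'a" where
  "ann_vecs n v 0 D = D"
| "ann_vecs n v (Suc l) D = ann_vec n (v l) (ann_vecs n v l D)"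

primrec cre_vecs :: "nat \<Rightarrow> (nat \<Rightarrow> nat \<Rightarrow> 'a::comm_ring_1) \<Rightarrow> nat \<Rightarrow> (nat set \<Rightarrow> 'a) \<Rightarrow> nat set \<Rightarrow> 'a" where
  "cre_vecs n v 0 D = D"
| "cre_vecs n v (Suc l) D = cre_vec n (v l) (cre_vecs n v l D)"

lemma ann_vecs_scale: "ann_vecs n v l (\<lambda>S. c * D S) = (\<lambda>S. c * ann_vecs n v l D S)"
  by (induction l) (auto simp: ann_vec_scale)

lemma cre_vecs_zero: "cre_vecs n v l (\<lambda>S. 0) = (\<lambda>S. 0)"
  by (induction l) auto

lemma ann_vecs_zero: "ann_vecs n v l (\<lambda>S. 0) = (\<lambda>S. 0)"
  by (induction l) auto

definition dual_basis :: "nat \<Rightarrow> nat \<Rightarrow> (nat \<Rightarrow> nat \<Rightarrow> 'a::comm_ring_1) \<Rightarrow> (nat \<Rightarrow> nat \<Rightarrow> 'a) \<Rightarrow> bool" where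
  "dual_basis n l v u \<longleftrightarrow> (\<forall>j<l. \<forall>k<l. (\<Sum>i<n. v j i * u k i) = (if j = k then 1 else 0))"

text \<open>As \<open>v l\<close> kills \<open>D\<close>, contracting the wedge of
  \<open>u l\<close> with \<open>D\<close> returns \<open>D\<close>. That wedge is still killed by
  the other covectors, since they vanish on \<open>u l\<close>, so the induction continues one
  degree higher.\<close>

lemma annihilated_eq_ann_vecs:
  assumes "dual_basis n l v u" "of_degree n d D" "\<And>j S. j < l \<Longrightarrow> ann_vec n (v j) D S = 0"
  shows "\<exists>E. of_degree n (d + int l) E \<and> D = ann_vecs n v l E"
  using assms
proof (induction l arbitrary: d D)
  case (Suc l)
  let ?D = "cre_vec n (u l) D"
  have zero: "cre_vec n (u l) (ann_vec n (v j) D) S = 0" if "j < Suc l" for j S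
  proof -
    have "ann_vec n (v j) D = (\<lambda>S. 0)" using Suc.prems(3)[OF that] by blast
    then show ?thesis by simp
  qed
  have dual: "(\<Sum>i<n. v j i * u l i) = (if j = l then 1 else 0)" if "j < Suc l" for j
    using Suc.prems(1) that by (simp add: dual_basis_def)
  have "ann_vec n (v j) ?D S = 0" if "j < l" for j S
    using ann_vec_cre_vec[of n "v j" "u l" D S] zero[of j] dual[of j] that by simp
  moreover have "dual_basis n l v u" using Suc.prems(1) by (simp add: dual_basis_def)
  ultimately obtain E where E: "of_degree n (d + 1 + int l) E" "?D = ann_vecs n v l E"
    using Suc.IH[OF _ of_degree_cre_vec[OF Suc.prems(2)]] by blast
  have "ann_vec n (v l) ?D S = D S" for S
    using ann_vec_cre_vec[of n "v l" "u l" D S] zero[of l] dual[of l] by simp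
  then have "D = ann_vecs n v (Suc l) E" using E(2) by (auto simp: fun_eq_iff)
  then show ?case using E(1) by (intro exI[of _ E]) (simp add: algebra_simps)
qed auto

text \<open>The same argument with wedge and contraction exchanged: \<open>D\<close> is divisible by
  each \<open>v j\<close>, and contraction with \<open>u l\<close> splits off the last
  factor.\<close>

lemma divisible_eq_cre_vecs:
  assumes "dual_basis n l v u" "of_degree n d D" "\<And>j S. j < l \<Longrightarrow> cre_vec n (v j) D S = 0"
  shows "\<exists>E. of_degree n (d - int l) E \<and> D = cre_vecs n v l E"
  using assms
proof (induction l arbitrary: d D)
  case (Suc l)
  let ?D = "ann_vec n (u l) D"
  have zero: "ann_vec n (u l) (cre_vec n (v j) D) S = 0" if "j < Suc l" for j S
  proof -
    have "cre_vec n (v j) D = (\<lambda>S. 0)" using Suc.prems(3)[OF that] by blast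
    then show ?thesis by simp
  qed
  have dual: "(\<Sum>i<n. u l i * v j i) = (if j = l then 1 else 0)" if "j < Suc l" for j
    using Suc.prems(1) that by (simp add: dual_basis_def mult.commute)
  have "cre_vec n (v j) ?D S = 0" if "j < l" for j S
    using ann_vec_cre_vec[of n "u l" "v j" D S] zero[of j] dual[of j] that by simp
  moreover have "dual_basis n l v u" using Suc.prems(1) by (simp add: dual_basis_def)
  ultimately obtain E where E: "of_degree n (d - 1 - int l) E" "?D = cre_vecs n v l E"
    using Suc.IH[OF _ of_degree_ann_vec[OF Suc.prems(2)]] by blast
  have "cre_vec n (v l) ?D S = D S" for S
    using ann_vec_cre_vec[of n "u l" "v l" D S] zero[of l] dual[of l] by simp
  then have "D = cre_vecs n v (Suc l) E" using E(2) by (auto simp: fun_eq_iff)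
  then show ?case using E(1) by (intro exI[of _ E]) (simp add: algebra_simps)
qed auto

text \<open>The wedge with \<open>u\<close> passes each contraction up to sign because the pairings
  vanish, and on the top multivector it gives degree n + 1.\<close>

lemma cre_vec_ann_vecs_top:
  assumes "\<And>j. j < l \<Longrightarrow> (\<Sum>i<n. v j i * u i) = 0"
  shows "cre_vec n u (ann_vecs n v l (top_coeff n)) S = 0"
  using assms
proof (induction l arbitrary: S)
  case 0
  have "of_degree n (int n) (top_coeff n :: nat set \<Rightarrow> 'a)"
    by (auto simp: of_degree_def top_coeff_def)
  from of_degree_eq_0[OF of_degree_cre_vec[OF this]] show ?case by simp
next
  case (Suc l)
  let ?X = "ann_vecs n v l (top_coeff n)"
  have "cre_vec n u ?X = (\<lambda>S. 0)" using Suc.IH Suc.prems by auto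
  then show ?case using ann_vec_cre_vec[of n "v l" u ?X S] Suc.prems[of l] by simp
qed

text \<open>Wedging with \<open>u l\<close> undoes the last contraction, so no contraction in the
  sequence can produce zero.\<close>

lemma ann_vecs_top_nonzero:
  assumes "dual_basis n l v u"
  shows "\<exists>S. ann_vecs n v l (top_coeff n) S \<noteq> 0"
  using assms
proof (induction l)
  case 0
  show ?case by (rule exI[of _ "{..<n}"]) (simp add: top_coeff_def)
next
  case (Suc l)
  let ?X = "ann_vecs n v l (top_coeff n)"
  obtain S where S: "?X S \<noteq> 0" using Suc by (auto simp: dual_basis_def)
  have "cre_vec n (u l) ?X S = 0" for S
    by (rule cre_vec_ann_vecs_top) (use Suc.prems in \<open>simp add: dual_basis_def\<close>)
  then have "cre_vec n (u l) ?X = (\<lambda>S. 0)" by blast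
  then have "cre_vec n (u l) (ann_vec n (v l) ?X) S = ?X S"
    using ann_vec_cre_vec[of n "v l" "u l" ?X S] Suc.prems by (simp add: dual_basis_def)
  then have "ann_vec n (v l) ?X \<noteq> (\<lambda>S. 0)" using S by auto
  then show ?case by auto
qed

text \<open>Contractions anticommute, so a repeated covector gives an element equal to its own
  negative, which is zero in characteristic 0.\<close>

lemma ann_vec_ann_vecs:
  fixes v :: "nat \<Rightarrow> nat \<Rightarrow> 'a::field_char_0"
  assumes "j < l"
  shows "ann_vec n (v j) (ann_vecs n v l D) S = 0"
  using assms
proof (induction l arbitrary: S)
  case (Suc l)
  show ?case
  proof (cases "j = l")
    case True
    then show ?thesis using ann_vec_ann_vec[of n "v l" "v l" "ann_vecs n v l D" S] by simp
  next
    case False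
    then have "ann_vec n (v j) (ann_vecs n v l D) = (\<lambda>S. 0)" using Suc by auto
    then show ?thesis using ann_vec_ann_vec[of n "v j" "v l" "ann_vecs n v l D" S] by simp
  qed
qed simp

text \<open>Either the dependence already involves only the first \<open>l\<close> covectors, or the
  last one is a combination of the earlier ones, whose further contraction vanishes.\<close>

lemma ann_vecs_eq_0_if_dependent:
  fixes v :: "nat \<Rightarrow> nat \<Rightarrow> 'a::field_char_0"
  assumes "\<not> lin_indep n {..<l} v"
  shows "ann_vecs n v l D S = 0"
  using assms
proof (induction l arbitrary: S)
  case 0
  then show ?case by (simp add: lin_indep_def)
next
  case (Suc l)
  let ?X = "ann_vecs n v l D"
  obtain c j where c: "\<And>i. i < n \<Longrightarrow> (\<Sum>j<Suc l. c j * v j i) = 0" and j: "j < Suc l" "c j \<noteq> 0"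
    using Suc.prems unfolding lin_indep_def by blast
  show ?case
  proof (cases "c l = 0")
    case True
    then have "j < l" using j by (cases "j = l") auto
    then have "\<not> lin_indep n {..<l} v"
      unfolding lin_indep_def using c j True by (auto intro!: exI[of _ c])
    then have "?X = (\<lambda>S. 0)" using Suc.IH by blast
    then show ?thesis by simp
  next
    case False
    have "(\<Sum>j<Suc l. c j * ann_vec n (v j) ?X S) = (\<Sum>i<n. (\<Sum>j<Suc l. c j * v j i) * ann i ?X S)"
      unfolding ann_vec_def sum_distrib_left sum_distrib_right
      by (subst sum.swap) (simp add: mult.assoc)
    then have "(\<Sum>j<Suc l. c j * ann_vec n (v j) ?X S) = 0" using c by simp
    then have "c l * ann_vec n (v l) ?X S = 0" by (simp add: ann_vec_ann_vecs)
    then show ?thesis using False by simp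
  qed
qed

lemma lin_indepD:
  assumes "lin_indep n J v" "\<And>i. i < n \<Longrightarrow> (\<Sum>j\<in>J. c j * v j i) = 0" "j \<in> J"
  shows "c j = 0"
  using assms(2,3) spec[OF assms(1)[unfolded lin_indep_def], of c] by simp

text \<open>An elimination step: extend a dual system for the first \<open>l\<close> covectors by a
  vector \<open>x\<close> in their common kernel on which \<open>v l\<close> is 1, then correct the
  old vectors by multiples of \<open>x\<close>.\<close>

lemma dual_basis_exists:
  fixes v :: "nat \<Rightarrow> nat \<Rightarrow> 'a::field"
  assumes "lin_indep n {..<l} v"
  shows "\<exists>u. dual_basis n l v u"
  using assms
proof (induction l)
  case 0
  then show ?case by (simp add: dual_basis_def)
next
  case (Suc l)
  have "lin_indep n {..<l} v"
    unfolding lin_indep_def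
  proof (intro allI impI ballI)
    fix c j assume c: "\<forall>i<n. (\<Sum>j<l. c j * v j i) = 0" and j: "j \<in> {..<l}"
    have "(if j = l then 0 else c j) = 0"
      by (rule lin_indepD[OF Suc.prems]) (use c j in auto)
    then show "c j = 0" using j by auto
  qed
  then obtain u where "dual_basis n l v u" using Suc.IH by blast
  then have u: "(\<Sum>i<n. v j i * u k i) = (if j = k then 1 else 0)" if "j < l" "k < l" for j k
    using that by (simp add: dual_basis_def)
  define b where "b k = (\<Sum>i<n. v l i * u k i)" for k
  \<comment> \<open>\<open>v'\<close> is \<open>v l\<close> minus its part along the earlier
    covectors; independence makes some coordinate \<open>i0\<close> of it nonzero.\<close>
  define v' where "v' i = v l i - (\<Sum>k<l. b k * v k i)" for i
  have "\<exists>i<n. v' i \<noteq> 0"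
  proof (rule ccontr)
    assume "\<not> ?thesis"
    then have "(\<Sum>j<Suc l. (if j = l then 1 else - b j) * v j i) = 0" if "i < n" for i
      using that by (simp add: v'_def sum_negf)
    from lin_indepD[OF Suc.prems this, of l] show False by simp
  qed
  then obtain i0 where i0: "i0 < n" "v' i0 \<noteq> 0" by blast
  \<comment> \<open>The basis vector with index \<open>i0\<close>, projected to the common kernel of
    the earlier covectors; \<open>v l\<close> takes the value \<open>v' i0\<close> on this
    projection.\<close>
  define x where "x i = ((if i = i0 then 1 else 0) - (\<Sum>k<l. v k i0 * u k i)) / v' i0" for i
  have pair_x: "(\<Sum>i<n. v j i * x i) = (v j i0 - (\<Sum>k<l. v k i0 * (\<Sum>i<n. v j i * u k i))) / v' i0" for j
  proof -
    have "(\<Sum>i<n. v j i * (\<Sum>k<l. v k i0 * u k i)) = (\<Sum>k<l. v k i0 * (\<Sum>i<n. v j i * u k i))"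
      unfolding sum_distrib_left by (subst sum.swap) (simp add: mult_ac)
    moreover have "(\<Sum>i<n. v j i * (if i = i0 then 1 else 0)) = v j i0"
      using i0(1) by (simp add: if_distrib[of "\<lambda>x. _ * x"] cong: if_cong)
    ultimately show ?thesis
      by (simp add: x_def right_diff_distrib sum_subtractf flip: sum_divide_distrib)
  qed
  have x1: "(\<Sum>i<n. v j i * x i) = 0" if "j < l" for j
    using that by (simp add: pair_x u if_distrib[of "\<lambda>x. _ * x"] cong: if_cong)
  have x2: "(\<Sum>i<n. v l i * x i) = 1"
    using i0(2) unfolding pair_x b_def[symmetric] by (simp add: v'_def mult.commute)
  define u' where "u' k i = (if k = l then x i else u k i - b k * x i)" for k i
  have "dual_basis n (Suc l) v u'"
    unfolding dual_basis_def
  proof (intro allI impI)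
    fix j k assume jk: "j < Suc l" "k < Suc l"
    show "(\<Sum>i<n. v j i * u' k i) = (if j = k then 1 else 0)"
    proof (cases "k = l")
      case True
      then show ?thesis using x1[of j] x2 jk by (auto simp: u'_def less_Suc_eq)
    next
      case False
      have "(\<Sum>i<n. v j i * u' k i) = (\<Sum>i<n. v j i * u k i) - b k * (\<Sum>i<n. v j i * x i)"
        using False by (simp add: u'_def right_diff_distrib sum_subtractf sum_distrib_left mult_ac)
      then show ?thesis using False jk x1[of j] x2 u[of j k] by (auto simp: less_Suc_eq b_def)
    qed
  qed
  then show ?case by blast
qed

text \<open>For independent covectors \<open>D\<close> is an iterated contraction of an element of
  degree n, hence of a multiple of the top one. For dependent covectors both sides vanish, so the
  identity holds at every point.\<close>

lemma annihilated_proportional: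
  fixes v :: "nat \<Rightarrow> nat \<Rightarrow> 'a::field_char_0"
  assumes "of_degree n d D" "d + int l = int n" "\<And>j S. j < l \<Longrightarrow> ann_vec n (v j) D S = 0"
  shows "D S * ann_vecs n v l (top_coeff n) T = D T * ann_vecs n v l (top_coeff n) S"
proof (cases "lin_indep n {..<l} v")
  case True
  then obtain u where u: "dual_basis n l v u" using dual_basis_exists by blast
  obtain E where E: "of_degree n (int n) E" "D = ann_vecs n v l E"
    using annihilated_eq_ann_vecs[OF u assms(1,3)] assms(2) by auto
  have "E = (\<lambda>S. E {..<n} * top_coeff n S)" using of_degree_top[OF E(1)] by blast
  then have "D = (\<lambda>S. E {..<n} * ann_vecs n v l (top_coeff n) S)"
    unfolding E(2) by (metis ann_vecs_scale)
  then show ?thesis by simp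
qed (simp add: ann_vecs_eq_0_if_dependent)

text \<open>Otherwise \<open>D\<close> would be an iterated contraction of an element of degree
  above n. This bound later yields evenness of the generic rank.\<close>

lemma annihilated_degree_le:
  fixes v :: "nat \<Rightarrow> nat \<Rightarrow> 'a::field_char_0"
  assumes "of_degree n d D" "\<And>j S. j < l \<Longrightarrow> ann_vec n (v j) D S = 0"
    and "lin_indep n {..<l} v" "D S \<noteq> 0"
  shows "d + int l \<le> int n"
proof (rule ccontr)
  assume *: "\<not> ?thesis"
  obtain u where u: "dual_basis n l v u" using dual_basis_exists assms(3) by blast
  obtain E where E: "of_degree n (d + int l) E" "D = ann_vecs n v l E"
    using annihilated_eq_ann_vecs[OF u assms(1,2)] by blast
  have "E = (\<lambda>S. 0)" using of_degree_eq_0[OF E(1)] * by auto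
  then show False using E(2) assms(4) by (simp add: ann_vecs_zero)
qed

subsection \<open>Exterior powers of a bivector\<close>

text \<open>Left wedge multiplication by the bivector with coefficients \<open>M i j\<close>, i <
  j.\<close>

definition bivec_op :: "nat \<Rightarrow> (nat \<Rightarrow> nat \<Rightarrow> 'a::comm_ring_1) \<Rightarrow> (nat set \<Rightarrow> 'a) \<Rightarrow> nat set \<Rightarrow> 'a" where
  "bivec_op n M D S = (\<Sum>i<n. \<Sum>j<n. if i < j then M i j * cre i (cre j D) S else 0)"

definition unit_coeff :: "nat set \<Rightarrow> 'a::comm_ring_1" where
  "unit_coeff S = (if S = {} then 1 else 0)"

lemma sum_symmetric_pairs:
  fixes F :: "nat \<Rightarrow> nat \<Rightarrow> 'a::comm_ring_1"
  assumes "\<And>i j. i < n \<Longrightarrow> j < n \<Longrightarrow> F i j = F j i" "\<And>i. i < n \<Longrightarrow> F i i = 0"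
  shows "(\<Sum>i<n. \<Sum>j<n. F i j) = 2 * (\<Sum>i<n. \<Sum>j<n. if i < j then F i j else 0)"
proof -
  let ?L = "\<Sum>i<n. \<Sum>j<n. if i < j then F i j else 0"
  have "(\<Sum>i<n. \<Sum>j<n. F i j) = (\<Sum>i<n. \<Sum>j<n. (if i < j then F i j else 0) + (if j < i then F j i else 0))"
  proof (intro sum.cong refl)
    fix i j assume "i \<in> {..<n}" "j \<in> {..<n}"
    then show "F i j = (if i < j then F i j else 0) + (if j < i then F j i else 0)"
      using assms(1)[of i j] assms(2)[of i] by (cases i j rule: linorder_cases) auto
  qed
  also have "\<dots> = ?L + (\<Sum>i<n. \<Sum>j<n. if j < i then F j i else 0)"
    by (simp add: sum.distrib)
  also have "(\<Sum>i<n. \<Sum>j<n. if j < i then F j i else 0) = ?L"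
    by (rule sum.swap)
  finally show ?thesis by simp
qed

context
  fixes n :: nat and M :: "nat \<Rightarrow> nat \<Rightarrow> 'a::field_char_0"
  assumes skew: "\<And>i j. i < n \<Longrightarrow> j < n \<Longrightarrow> M i j = - M j i"
begin

text \<open>Skewness makes the summand symmetric in i and j. The unrestricted double sum is easier
  to rearrange, and the factor 2 can be cancelled.\<close>

lemma bivec_op_double: "2 * bivec_op n M D S = (\<Sum>i<n. \<Sum>j<n. M i j * cre i (cre j D) S)"
proof -
  have "M i i = 0" if "i < n" for i using skew[OF that that] by simp
  then show ?thesis
    unfolding bivec_op_def
  proof (intro sum_symmetric_pairs[symmetric])
    fix i j assume "i < n" "j < n"
    then show "M i j * cre i (cre j D) S = M j i * cre j (cre i D) S"
      using skew[of i j] cre_cre[of i j D S] by simp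
  qed simp
qed

text \<open>A bivector has even degree: passing two creation operators changes the sign
  twice.\<close>

lemma cre_vec_bivec_op: "cre_vec n w (bivec_op n M D) S = bivec_op n M (cre_vec n w D) S"
proof -
  have comm: "cre k (cre i (cre j D)) S = cre i (cre j (cre k D)) S" for i j k
  proof -
    have "cre k (cre i (cre j D)) S = - cre i (cre k (cre j D)) S" by (rule cre_cre)
    also have "cre k (cre j D) = (\<lambda>S. (-1) * cre j (cre k D) S)" using cre_cre[of k j D] by auto
    finally show ?thesis by (simp only: cre_scale) simp
  qed
  have "2 * cre_vec n w (bivec_op n M D) S = cre_vec n w (\<lambda>S. 2 * bivec_op n M D S) S"
    by (simp add: cre_vec_scale)
  also have "\<dots> = (\<Sum>k<n. \<Sum>i<n. \<Sum>j<n. w k * M i j * cre k (cre i (cre j D)) S)"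
    unfolding bivec_op_double cre_vec_def cre_sum cre_scale by (simp add: sum_distrib_left mult.assoc)
  also have "\<dots> = (\<Sum>k<n. \<Sum>i<n. \<Sum>j<n. w k * M i j * cre i (cre j (cre k D)) S)"
    by (subst comm) (rule refl)
  also have "\<dots> = (\<Sum>i<n. \<Sum>j<n. \<Sum>k<n. w k * M i j * cre i (cre j (cre k D)) S)"
    by (subst sum.swap) (intro sum.cong refl sum.swap)
  also have "\<dots> = 2 * bivec_op n M (cre_vec n w D) S"
    unfolding bivec_op_double cre_vec_def[abs_def] cre_sum cre_scale
    by (simp add: sum_distrib_left mult_ac)
  finally show ?thesis by simp
qed

text \<open>The Leibniz rule for contraction, with no sign as the bivector is even. The extra term
  is the wedge with the contracted bivector, whose coordinates are the combination of the rows of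
  \<open>M\<close> with coefficients \<open>v\<close>.\<close>

lemma ann_vec_bivec_op:
  "ann_vec n v (bivec_op n M D) S =
    bivec_op n M (ann_vec n v D) S + cre_vec n (\<lambda>j. \<Sum>i<n. v i * M i j) D S"
proof -
  have ann_sum': "ann_vec n v (\<lambda>S. \<Sum>x\<in>A. f x S) S = (\<Sum>x\<in>A. ann_vec n v (f x) S)" for A :: "nat set" and f
    unfolding ann_vec_def ann_sum by (subst sum.swap) (simp add: sum_distrib_left)
  have comm: "ann_vec n v (cre i (cre j D)) S = v i * cre j D S - v j * cre i D S + cre i (cre j (ann_vec n v D)) S"
    if "i < n" "j < n" for i j
  proof -
    have "ann_vec n v (cre i (cre j D)) S = v i * cre j D S - cre i (ann_vec n v (cre j D)) S"
      by (rule ann_vec_cre[OF that(1)])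
    also have "ann_vec n v (cre j D) = (\<lambda>S. v j * D S - cre j (ann_vec n v D) S)"
      using ann_vec_cre[OF that(2)] by blast
    finally show ?thesis by (simp add: cre_diff cre_scale)
  qed
  have "2 * ann_vec n v (bivec_op n M D) S = ann_vec n v (\<lambda>S. 2 * bivec_op n M D S) S"
    by (simp add: ann_vec_scale)
  also have "\<dots> = (\<Sum>i<n. \<Sum>j<n. M i j * ann_vec n v (cre i (cre j D)) S)"
    unfolding bivec_op_double ann_sum' ann_vec_scale ..
  also have "\<dots> = (\<Sum>i<n. \<Sum>j<n. M i j * (v i * cre j D S) - M i j * (v j * cre i D S) + M i j * cre i (cre j (ann_vec n v D)) S)"
    by (intro sum.cong refl) (simp add: comm algebra_simps)
  also have "\<dots> = (\<Sum>i<n. \<Sum>j<n. M i j * (v i * cre j D S)) - (\<Sum>i<n. \<Sum>j<n. M i j * (v j * cre i D S))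
      + 2 * bivec_op n M (ann_vec n v D) S"
    by (simp add: sum.distrib sum_subtractf bivec_op_double)
  also have "(\<Sum>i<n. \<Sum>j<n. M i j * (v j * cre i D S)) = - (\<Sum>i<n. \<Sum>j<n. M j i * (v j * cre i D S))"
    unfolding sum_negf[symmetric] by (intro sum.cong refl) (use skew in \<open>metis lessThan_iff minus_mult_left\<close>)
  also have "(\<Sum>i<n. \<Sum>j<n. M i j * (v i * cre j D S)) = (\<Sum>i<n. \<Sum>j<n. M j i * (v j * cre i D S))"
    by (rule sum.swap)
  also have "(\<Sum>i<n. \<Sum>j<n. M j i * (v j * cre i D S)) = cre_vec n (\<lambda>j. \<Sum>i<n. v i * M i j) D S"
    unfolding cre_vec_def sum_distrib_right by (simp add: mult_ac)
  finally have "2 * ann_vec n v (bivec_op n M D) S =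
      2 * (bivec_op n M (ann_vec n v D) S + cre_vec n (\<lambda>j. \<Sum>i<n. v i * M i j) D S)"
    by (simp add: algebra_simps)
  then show ?thesis by (subst (asm) mult_left_cancel) simp_all
qed

abbreviation (input) "bivec_power m \<equiv> (bivec_op n M ^^ m) unit_coeff"

text \<open>The power rule for the derivation in \<open>ann_vec_bivec_op\<close>: all m + 1 terms
  agree, since the contracted bivector commutes with the bivector.\<close>

lemma ann_vec_bivec_power:
  "ann_vec n v (bivec_power (Suc m)) S = of_nat (Suc m) * cre_vec n (\<lambda>j. \<Sum>i<n. v i * M i j) (bivec_power m) S"
proof (induction m arbitrary: S)
  case 0
  have "ann_vec n v unit_coeff = (\<lambda>S. 0)"
    by (rule ext) (simp add: ann_vec_def ann_def unit_coeff_def cong: if_cong)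
  then have "bivec_op n M (ann_vec n v unit_coeff) S = 0"
    by (simp add: bivec_op_def cre_def cong: if_cong)
  then show ?case using ann_vec_bivec_op[of v unit_coeff S] by simp
next
  case (Suc m)
  let ?u = "\<lambda>j. \<Sum>i<n. v i * M i j"
  have scale: "bivec_op n M (\<lambda>S. c * D S) S = c * bivec_op n M D S" for c D
  proof -
    have "cre i (cre j (\<lambda>S. c * D S)) S = c * cre i (cre j D) S" for i j
      by (simp add: cre_def mult.left_commute)
    then have "2 * bivec_op n M (\<lambda>S. c * D S) S = c * (2 * bivec_op n M D S)"
      unfolding bivec_op_double by (simp add: sum_distrib_left mult_ac)
    then show ?thesis by simp
  qed
  have "ann_vec n v (bivec_power (Suc m)) = (\<lambda>S. of_nat (Suc m) * cre_vec n ?u (bivec_power m) S)"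
    using Suc.IH by blast
  then have "bivec_op n M (ann_vec n v (bivec_power (Suc m))) S
      = of_nat (Suc m) * cre_vec n ?u (bivec_power (Suc m)) S"
    by (simp add: scale cre_vec_bivec_op del: of_nat_Suc)
  then show ?case
    using ann_vec_bivec_op[of v "bivec_power (Suc m)" S] by (simp add: algebra_simps)
qed

lemma of_degree_bivec_power: "of_degree n (2 * int m) (bivec_power m)"
proof (induction m)
  case 0
  show ?case by (simp add: of_degree_def unit_coeff_def)
next
  case (Suc m)
  show ?case
    unfolding of_degree_def
  proof (intro allI impI)
    fix S assume "bivec_power (Suc m) S \<noteq> 0"
    then have "(\<Sum>i<n. \<Sum>j<n. if i < j then M i j * cre i (cre j (bivec_power m)) S else 0) \<noteq> 0"
      by (simp add: bivec_op_def)
    then obtain i where i: "i \<in> {..<n}"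
      "(\<Sum>j<n. if i < j then M i j * cre i (cre j (bivec_power m)) S else 0) \<noteq> 0"
      by (rule sum.not_neutral_contains_not_neutral)
    from i(2) obtain j where j: "j \<in> {..<n}" "(if i < j then M i j * cre i (cre j (bivec_power m)) S else 0) \<noteq> 0"
      by (rule sum.not_neutral_contains_not_neutral)
    then have ij: "i < j" "cre i (cre j (bivec_power m)) S \<noteq> 0" by (auto split: if_splits)
    then have iS: "i \<in> S" "j \<in> S - {i}" "bivec_power m (S - {i} - {j}) \<noteq> 0"
      by (auto simp: cre_def split: if_splits)
    then have *: "S - {i} - {j} \<subseteq> {..<n}" "int (card (S - {i} - {j})) = 2 * int m"
      using Suc by (auto simp: of_degree_def)
    have sub: "S \<subseteq> {..<n}" using *(1) i(1) j(1) by auto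
    then have fin: "finite S" by (rule finite_subset) simp
    have "Suc (card (S - {i} - {j})) = card (S - {i})" "Suc (card (S - {i})) = card S"
      using fin iS by (intro card_Suc_Diff1; simp)+
    then show "S \<subseteq> {..<n} \<and> int (card S) = 2 * int (Suc m)" using sub *(2) by simp
  qed
qed

text \<open>If the first vanishing power has exponent \<open>m + 1\<close>, contracting it shows that the nonzero
  \<open>m\<close>-th power is divisible by all rows of the matrix, so the rank is at most \<open>2 m\<close>.\<close>

lemma bivec_power_nonzero:
  assumes "J \<subseteq> {..<n}" "lin_indep n J M"
  shows "\<exists>S. bivec_power ((card J + 1) div 2) S \<noteq> 0"
proof (rule ccontr)
  \<comment> \<open>Rounded up, so that for odd \<open>card J\<close> the claim is stronger than the
    one for the integer part of half the rank.\<close>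
  let ?p = "(card J + 1) div 2"
  assume "\<not> ?thesis"
  then have p: "\<forall>S. bivec_power ?p S = 0" by blast
  define q where "q = (LEAST q. \<forall>S. bivec_power q S = 0)"
  have q: "\<forall>S. bivec_power q S = 0" unfolding q_def using p by (rule LeastI)
  have "q \<le> ?p" unfolding q_def using p by (rule Least_le)
  have "q \<noteq> 0"
  proof
    assume "q = 0"
    then show False using q[rule_format, of "{}"] by (simp add: unit_coeff_def)
  qed
  then obtain m where m: "q = Suc m" by (cases q) auto
  have nz: "\<not> (\<forall>S. bivec_power m S = 0)"
    using not_less_Least[of m "\<lambda>q. \<forall>S. bivec_power q S = 0"] m by (simp add: q_def)
  have div: "cre_vec n (M j) (bivec_power m) S = 0" if "j < n" for j S
  proof -
    let ?e = "\<lambda>i. if i = j then 1 else 0 :: 'a"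
    have "bivec_power (Suc m) = (\<lambda>S. 0)" using q m by auto
    then have "ann_vec n ?e (bivec_power (Suc m)) S = 0" by simp
    \<comment> \<open>The factor m + 1 is invertible in characteristic 0. The covector
      \<open>?e\<close> selects row \<open>j\<close> of the matrix.\<close>
    then have "cre_vec n (\<lambda>k. \<Sum>i<n. ?e i * M i k) (bivec_power m) S = 0"
      unfolding ann_vec_bivec_power by (simp del: of_nat_Suc)
    moreover have "(\<Sum>i<n. ?e i * M i k) = M j k" for k
      using that by (simp add: if_distrib[of "\<lambda>x. x * _"] cong: if_cong)
    ultimately show ?thesis by simp
  qed
  have fin: "finite J" using assms(1) by (rule finite_subset) simp
  obtain h where h: "bij_betw h {..<card J} J"
    using ex_bij_betw_nat_finite[OF fin] by (auto simp: atLeast0LessThan)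
  have "lin_indep n {..<card J} (\<lambda>k. M (h k))"
    unfolding lin_indep_def
  proof (intro allI impI ballI)
    fix c k assume c: "\<forall>i<n. (\<Sum>k<card J. c k * M (h k) i) = 0" and k: "k \<in> {..<card J}"
    let ?h' = "the_inv_into {..<card J} h"
    have inv: "?h' (h k) = k" if "k < card J" for k
      using h that by (simp add: the_inv_into_f_f bij_betw_def)
    have "c (?h' (h k)) = 0"
    proof (rule lin_indepD[OF assms(2), of "\<lambda>j. c (?h' j)"])
      fix i assume "i < n"
      have "(\<Sum>j\<in>J. c (?h' j) * M j i) = (\<Sum>k<card J. c (?h' (h k)) * M (h k) i)"
        using h by (rule sum.reindex_bij_betw[symmetric])
      also have "\<dots> = 0" using c \<open>i < n\<close> by (simp add: inv)
      finally show "(\<Sum>j\<in>J. c (?h' j) * M j i) = 0" .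
    next
      show "h k \<in> J" using h k by (auto simp: bij_betw_def)
    qed
    then show "c k = 0" using inv k by simp
  qed
  then obtain u where u: "dual_basis n (card J) (\<lambda>k. M (h k)) u" using dual_basis_exists by blast
  have "h k < n" if "k < card J" for k using h assms(1) that by (auto simp: bij_betw_def)
  then have "cre_vec n (M (h k)) (bivec_power m) S = 0" if "k < card J" for k S
    using that by (simp add: div)
  then obtain E where E: "of_degree n (2 * int m - int (card J)) E"
    "bivec_power m = cre_vecs n (\<lambda>k. M (h k)) (card J) E"
    using divisible_eq_cre_vecs[OF u of_degree_bivec_power] by blast
  \<comment> \<open>From m + 1 at most \<open>?p\<close>, even after rounding up; so
    \<open>E\<close> has negative degree.\<close>
  have "2 * m < card J" using \<open>q \<le> ?p\<close> m by linarith
  then have "E = (\<lambda>S. 0)" using of_degree_eq_0[OF E(1)] by auto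
  then have "bivec_power m = (\<lambda>S. 0)" using E(2) by (simp only: cre_vecs_zero)
  then show False using nz by simp
qed

end

subsection \<open>Wedge products in terms of the operators\<close>

lemma wsign_insert_left:
  assumes "finite S" "finite T" "i \<notin> S"
  shows "(wsign (insert i S) T :: 'a::comm_ring_1) = wsign S T * sg i T"
proof -
  have eq: "{(s, t). s \<in> insert i S \<and> t \<in> T \<and> t < s}
      = {(s, t). s \<in> S \<and> t \<in> T \<and> t < s} \<union> {i} \<times> {t\<in>T. t < i}" by auto
  have "{(s, t). s \<in> S \<and> t \<in> T \<and> t < s} \<subseteq> S \<times> T" by auto
  then have "finite {(s, t). s \<in> S \<and> t \<in> T \<and> t < s}"
    by (rule finite_subset) (use assms in simp)
  then have "card {(s, t). s \<in> insert i S \<and> t \<in> T \<and> t < s}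
      = card {(s, t). s \<in> S \<and> t \<in> T \<and> t < s} + card ({i} \<times> {t\<in>T. t < i})"
    unfolding eq using assms by (intro card_Un_disjoint) auto
  then show ?thesis by (simp add: wsign_def sg_def power_add card_cartesian_product)
qed

lemma wsign_insert_right:
  assumes "finite S" "finite T" "i \<notin> T"
  shows "(wsign S (insert i T) :: 'a::comm_ring_1) = wsign S T * (-1) ^ card {s\<in>S. i < s}"
proof -
  have eq: "{(s, t). s \<in> S \<and> t \<in> insert i T \<and> t < s}
      = {(s, t). s \<in> S \<and> t \<in> T \<and> t < s} \<union> {s\<in>S. i < s} \<times> {i}" by auto
  have "{(s, t). s \<in> S \<and> t \<in> T \<and> t < s} \<subseteq> S \<times> T" by auto
  then have "finite {(s, t). s \<in> S \<and> t \<in> T \<and> t < s}"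
    by (rule finite_subset) (use assms in simp)
  then have "card {(s, t). s \<in> S \<and> t \<in> insert i T \<and> t < s}
      = card {(s, t). s \<in> S \<and> t \<in> T \<and> t < s} + card ({s\<in>S. i < s} \<times> {i})"
    unfolding eq using assms by (intro card_Un_disjoint) auto
  then show ?thesis by (simp add: wsign_def power_add card_cartesian_product)
qed

lemma wsign_empty [simp]: "wsign {} T = 1" "wsign S {} = 1"
  by (simp_all add: wsign_def)

text \<open>Only two-element subsets S of U contribute to the wedge, and they correspond to the
  pairs i < j. The support condition on \<open>D\<close> makes both sides vanish at sets not
  contained in \<open>{..<n}\<close>.\<close>

lemma wedge_bivector:
  fixes B :: "'a::comm_ring_1 mpoly \<Rightarrow> 'a mpoly \<Rightarrow> 'a mpoly"
  assumes "\<And>U. \<not> U \<subseteq> {..<n} \<Longrightarrow> D U = 0"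
  shows "wedge n (pi_bivector n B) D = bivec_op n (\<lambda>i j. B (Var i) (Var j)) D"
proof
  fix U
  let ?M = "\<lambda>i j. B (Var i) (Var j)"
  show "wedge n (pi_bivector n B) D U = bivec_op n ?M D U"
  proof (cases "U \<subseteq> {..<n}")
    case False
    have "cre i (cre j D) U = 0" if "i < n" "j < n" for i j
    proof -
      have "\<not> U - {i} - {j} \<subseteq> {..<n}" using False that by auto
      then show ?thesis using assms by (simp add: cre_def)
    qed
    then have "bivec_op n ?M D U = 0" by (simp add: bivec_op_def cong: if_cong)
    then show ?thesis using False by (simp add: wedge_def)
  next
    case True
    then have fin: "finite U" by (rule finite_subset) simp
    define K where "K = {(i, j). i \<in> U \<and> j \<in> U \<and> i < j}"
    let ?f = "\<lambda>S. wsign S (U - S) * pi_bivector n B S * D (U - S)"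
    let ?g = "\<lambda>(i, j). if i < j then ?M i j * cre i (cre j D) U else 0"
    have Ksub: "K \<subseteq> {..<n} \<times> {..<n}" using True by (auto simp: K_def)
    have "bivec_op n ?M D U = (\<Sum>p\<in>{..<n} \<times> {..<n}. ?g p)"
      by (simp add: bivec_op_def sum.cartesian_product)
    also have "\<dots> = (\<Sum>p\<in>K. ?g p)"
      using Ksub by (intro sum.mono_neutral_right) (auto simp: K_def cre_def split: if_splits)
    finally have R: "bivec_op n ?M D U = (\<Sum>p\<in>K. ?g p)" .
    let ?s = "\<lambda>(i :: nat, j). {i, j}"
    have inj: "inj_on ?s K"
      by (rule inj_onI) (auto simp: K_def doubleton_eq_iff)
    have "wedge n (pi_bivector n B) D U = (\<Sum>S\<in>Pow U. ?f S)"
      using True by (simp add: wedge_def)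
    also have "\<dots> = (\<Sum>S\<in>?s ` K. ?f S)"
    proof (rule sum.mono_neutral_right)
      show "\<forall>S\<in>Pow U - ?s ` K. ?f S = 0"
      proof
        fix S assume S: "S \<in> Pow U - ?s ` K"
        have "\<not> (\<exists>i j. i < j \<and> j < n \<and> S = {i, j})"
        proof
          assume "\<exists>i j. i < j \<and> j < n \<and> S = {i, j}"
          then obtain i j where ij: "i < j" "S = {i, j}" by blast
          then have "(i, j) \<in> K" using S by (auto simp: K_def)
          then show False using S ij by force
        qed
        then have "pi_bivector n B S = 0" unfolding pi_bivector_def by (rule if_not_P)
        then show "?f S = 0" by simp
      qed
    qed (use fin in \<open>auto simp: K_def\<close>)
    also have "\<dots> = (\<Sum>p\<in>K. ?f (?s p))"
      using inj by (simp add: sum.reindex)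
    also have "\<dots> = (\<Sum>p\<in>K. ?g p)"
    proof (rule sum.cong[OF refl])
      fix p assume "p \<in> K"
      then obtain i j where p: "p = (i, j)" "i \<in> U" "j \<in> U" "i < j" by (auto simp: K_def)
      then have jn: "j < n" using True by auto
      have pi: "pi_bivector n B {i, j} = ?M i j"
      proof -
        have "\<exists>i' j'. i' < j' \<and> j' < n \<and> {i, j} = {i', j'}" using p(4) jn by blast
        moreover have "Min {i, j} = i" "Max {i, j} = j" using p(4) by auto
        ultimately show ?thesis by (simp add: pi_bivector_def)
      qed
      have U: "U - {i, j} = U - {i} - {j}" by blast
      \<comment> \<open>Removing j does not change the position of the smaller index i, so the
        inversion sign is the product of the signs of the two successive creations.\<close>
      have "wsign {i, j} (U - {i, j}) = sg j (U - {i, j}) * (sg i (U - {i, j}) :: 'a mpoly)"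
        using wsign_insert_left[of "{j}" "U - {i, j}" i, where 'a = "'a mpoly"]
          wsign_insert_left[of "{}" "U - {i, j}" j, where 'a = "'a mpoly"] fin p(4) by simp
      also have "\<dots> = sg j (U - {i}) * sg i U"
        unfolding U using p by (simp add: sg_remove)
      finally have "?f {i, j} = ?M i j * (sg i U * (sg j (U - {i}) * D (U - {i} - {j})))"
        unfolding pi U by (simp add: mult_ac)
      then show "?f (?s p) = ?g p" using p by (simp add: cre_def)
    qed
    finally show ?thesis using R by simp
  qed
qed

lemma wpow_bivector:
  "wpow n (pi_bivector n B) m = (bivec_op n (\<lambda>i j. B (Var i) (Var j)) ^^ m) unit_coeff"
proof (induction m)
  case 0
  show ?case by (auto simp: wpow_def wunit_def unit_coeff_def)
next
  case (Suc m)
  have supp: "wpow n (pi_bivector n B) m U = 0" if "\<not> U \<subseteq> {..<n}" for U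
    using that by (cases m) (auto simp: wpow_def wunit_def wedge_def)
  have "wpow n (pi_bivector n B) (Suc m) = wedge n (pi_bivector n B) (wpow n (pi_bivector n B) m)"
    by (simp add: wpow_def)
  also have "\<dots> = bivec_op n (\<lambda>i j. B (Var i) (Var j)) (wpow n (pi_bivector n B) m)"
    using supp by (rule wedge_bivector)
  finally show ?case by (simp add: Suc)
qed

text \<open>Contracting the top multivector is a signed passage to complements, as in the Hodge
  star.\<close>

lemma j_op_top:
  "j_op n \<omega> (top_vec n) S = (if S \<subseteq> {..<n} then wsign S ({..<n} - S) * \<omega> ({..<n} - S) else 0)"
proof (cases "S \<subseteq> {..<n}")
  case True
  have "j_op n \<omega> (top_vec n) S = wedge n (wbasis S) \<omega> {..<n}"
    using True by (simp add: j_op_def pairing_def top_vec_def wbasis_def[of "{..<n}"]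
      if_distrib[of "\<lambda>x. _ * x"] cong: if_cong)
  also have "\<dots> = (\<Sum>T\<in>Pow {..<n}. wsign T ({..<n} - T) * wbasis S T * \<omega> ({..<n} - T))"
    by (simp add: wedge_def)
  also have "\<dots> = (\<Sum>T\<in>{S}. wsign T ({..<n} - T) * wbasis S T * \<omega> ({..<n} - T))"
    by (rule sum.mono_neutral_right) (use True in \<open>auto simp: wbasis_def\<close>)
  also have "\<dots> = wsign S ({..<n} - S) * \<omega> ({..<n} - S)"
    by (simp add: wbasis_def)
  finally show ?thesis using True by simp
qed (simp add: j_op_def)

lemma wedge_dform:
  assumes "U \<subseteq> {..<n}"
  shows "wedge n \<omega> (dform n f) U = (\<Sum>i\<in>U. wsign (U - {i}) {i} * \<omega> (U - {i}) * pderiv_var i f)"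
proof -
  have fin: "finite U" using assms by (rule finite_subset) simp
  have "wedge n \<omega> (dform n f) U = (\<Sum>S\<in>Pow U. wsign S (U - S) * \<omega> S * dform n f (U - S))"
    using assms by (simp add: wedge_def)
  also have "\<dots> = (\<Sum>T\<in>Pow U. wsign (U - T) T * \<omega> (U - T) * dform n f T)"
    by (rule sum.reindex_bij_witness[of _ "\<lambda>T. U - T" "\<lambda>T. U - T"]) (auto simp: double_diff)
  also have "\<dots> = (\<Sum>T\<in>(\<lambda>i. {i}) ` U. wsign (U - T) T * \<omega> (U - T) * dform n f T)"
    by (rule sum.mono_neutral_right) (use fin in \<open>auto simp: dform_def\<close>)
  also have "\<dots> = (\<Sum>i\<in>U. wsign (U - {i}) {i} * \<omega> (U - {i}) * dform n f {i})"
    by (simp add: sum.reindex inj_on_def)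
  also have "\<dots> = (\<Sum>i\<in>U. wsign (U - {i}) {i} * \<omega> (U - {i}) * pderiv_var i f)"
    using assms by (intro sum.cong refl) (auto simp: dform_def)
  finally show ?thesis .
qed

text \<open>Moving i from the right block to the left changes the inversion counts by its relations
  to the other n - 1 indices. Each of these lies in exactly one of four classes, by block and by
  side of i.\<close>

lemma complement_sign:
  assumes "i \<in> {..<n} - S" "S \<subseteq> {..<n}"
  shows "wsign S ({..<n} - S) * wsign ({..<n} - S - {i}) {i}
    = (-1) ^ (n - 1) * (sg i S * wsign (insert i S) ({..<n} - insert i S) :: 'a::comm_ring_1)"
proof -
  let ?X = "{..<n} - insert i S"
  have fin: "finite S" "finite ?X" using assms(2) finite_subset by auto
  have U: "{..<n} - S = insert i ?X" "{..<n} - S - {i} = ?X" using assms(1) by auto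
  have "wsign S (insert i ?X) = wsign S ?X * ((-1) ^ card {s\<in>S. i < s} :: 'a)"
    by (rule wsign_insert_right[OF fin]) simp
  moreover have "wsign (insert i S) ?X = wsign S ?X * (sg i ?X :: 'a)"
    by (rule wsign_insert_left[OF fin]) (use assms in simp)
  moreover have "wsign ?X {i} = ((-1) ^ card {s\<in>?X. i < s} :: 'a)"
    using wsign_insert_right[OF fin(2), of "{}" i, where 'a = 'a] by simp
  moreover have "(-1 :: 'a) ^ card {s\<in>S. i < s} * (-1) ^ card {s\<in>?X. i < s} = (-1) ^ (n - 1) * (sg i S * sg i ?X)"
  proof -
    let ?a = "card {s\<in>S. i < s}" and ?b = "card {s\<in>?X. i < s}"
    let ?c = "card {s\<in>S. s < i}" and ?d = "card {s\<in>?X. s < i}"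
    have "{s\<in>S. i < s} \<union> {s\<in>S. s < i} = S"
      using assms(1) by (force simp: not_less le_less)
    moreover have "card ({s\<in>S. i < s} \<union> {s\<in>S. s < i}) = ?a + ?c"
      using fin by (intro card_Un_disjoint) auto
    ultimately have S: "card S = ?a + ?c" by simp
    have "{s\<in>?X. i < s} \<union> {s\<in>?X. s < i} = ?X"
      by (force simp: not_less le_less)
    moreover have "card ({s\<in>?X. i < s} \<union> {s\<in>?X. s < i}) = ?b + ?d"
      using fin by (intro card_Un_disjoint) auto
    ultimately have X: "card ?X = ?b + ?d" by simp
    have "card ?X = n - card (insert i S)"
      using assms fin by (subst card_Diff_subset) auto
    moreover have "card (insert i S) = Suc (card S)" using assms(1) fin by simp
    moreover have "card (insert i S) \<le> n" using assms card_mono[of "{..<n}" "insert i S"] by simp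
    ultimately have n: "n - 1 = ?a + ?b + ?c + ?d" using S X by simp
    have sq: "(-1 :: 'a) ^ k * (-1) ^ k = 1" for k by (simp flip: power_mult_distrib)
    have "(-1) ^ (n - 1) * (sg i S * sg i ?X)
        = (-1) ^ ?a * (-1) ^ ?b * ((-1) ^ ?c * (-1) ^ ?c) * ((-1) ^ ?d * (-1 :: 'a) ^ ?d)"
      unfolding n sg_def by (simp only: power_add mult_ac)
    then show ?thesis by (simp add: sq)
  qed
  ultimately show ?thesis unfolding U by (simp add: mult_ac)
qed

text \<open>\<open>j_op\<close> multiplies forms on the right, while \<open>ann_vec\<close>
  contracts from the left. In the pairing with the top multivector, df moves past a form of degree n
  - 1, whence a sign independent of the degree of \<omega>.\<close>

lemma j_op_wedge_dform:
  "j_op n (wedge n \<omega> (dform n f)) (top_vec n) S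
    = (-1) ^ (n - 1) * ann_vec n (\<lambda>i. pderiv_var i f) (j_op n \<omega> (top_vec n)) S"
proof (cases "S \<subseteq> {..<n}")
  case False
  then have "ann i (j_op n \<omega> (top_vec n)) S = 0" for i by (auto simp: ann_def j_op_top)
  then show ?thesis using False by (simp add: j_op_top ann_vec_def)
next
  case True
  let ?U = "{..<n} - S" and ?j = "j_op n \<omega> (top_vec n)"
  have "j_op n (wedge n \<omega> (dform n f)) (top_vec n) S
      = (\<Sum>i\<in>?U. wsign S ?U * wsign (?U - {i}) {i} * \<omega> (?U - {i}) * pderiv_var i f)"
    using True by (simp add: j_op_top wedge_dform sum_distrib_left mult_ac)
  also have "\<dots> = (\<Sum>i\<in>?U. (-1) ^ (n - 1) * (pderiv_var i f * ann i ?j S))"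
  proof (rule sum.cong[OF refl])
    fix i assume i: "i \<in> ?U"
    have "?U - {i} = {..<n} - insert i S" by blast
    moreover have "ann i ?j S = sg i S * (wsign (insert i S) ({..<n} - insert i S) * \<omega> ({..<n} - insert i S))"
      using i True by (simp add: ann_def j_op_top)
    ultimately show "wsign S ?U * wsign (?U - {i}) {i} * \<omega> (?U - {i}) * pderiv_var i f
        = (-1) ^ (n - 1) * (pderiv_var i f * ann i ?j S)"
      unfolding complement_sign[OF i True] by (simp add: mult_ac)
  qed
  also have "\<dots> = (\<Sum>i<n. (-1) ^ (n - 1) * (pderiv_var i f * ann i ?j S))"
    by (rule sum.mono_neutral_left) (auto simp: ann_def)
  finally show ?thesis by (simp add: ann_vec_def sum_distrib_left)
qed

lemma j_op_dwedge:
  "j_op n (dwedge n Q l) (top_vec n)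
    = (\<lambda>S. ((-1) ^ (n - 1)) ^ l * ann_vecs n (\<lambda>k i. pderiv_var i (Q k)) l (top_coeff n) S)"
proof (induction l)
  case 0
  have "j_op n wunit (top_vec n) S = top_coeff n S" for S
    by (cases "S = {..<n}") (auto simp: j_op_top wunit_def top_coeff_def)
  then show ?case by auto
next
  case (Suc l)
  show ?case by (rule ext) (simp add: j_op_wedge_dform Suc ann_vec_scale mult_ac)
qed

section \<open>Evaluation of the coefficient families at a point\<close>

lemma eval_sg [simp]: "eval (sg i S) \<xi> = sg i S"
  by (simp add: sg_def)

lemma eval_cre: "eval (cre i D S) \<xi> = cre i (\<lambda>S. eval (D S) \<xi>) S"
  by (simp add: cre_def)

lemma eval_ann_vec:
  "eval (ann_vec n v D S) \<xi> = ann_vec n (\<lambda>i. eval (v i) \<xi>) (\<lambda>S. eval (D S) \<xi>) S"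
  by (simp add: ann_vec_def ann_def if_distrib[of "\<lambda>p. eval p \<xi>"] cong: if_cong)

lemma eval_ann_vecs_top:
  "eval (ann_vecs n v l (top_coeff n) S) \<xi> = ann_vecs n (\<lambda>k i. eval (v k i) \<xi>) l (top_coeff n) S"
proof (induction l arbitrary: S)
  case 0
  show ?case by (simp add: top_coeff_def)
next
  case (Suc l)
  then show ?case by (simp add: eval_ann_vec)
qed

lemma eval_bivec_power:
  "eval ((bivec_op n M ^^ m) unit_coeff S) \<xi> = (bivec_op n (\<lambda>i j. eval (M i j) \<xi>) ^^ m) unit_coeff S"
proof (induction m arbitrary: S)
  case 0
  show ?case by (simp add: unit_coeff_def)
next
  case (Suc m)
  have "eval (bivec_op n M D S) \<xi> = bivec_op n (\<lambda>i j. eval (M i j) \<xi>) (\<lambda>S. eval (D S) \<xi>) S" for D S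
    by (simp add: bivec_op_def eval_cre if_distrib[of "\<lambda>p. eval p \<xi>"] cong: if_cong)
  then show ?case by (simp add: Suc)
qed

lemma polyA_sign: "(-1) ^ k \<in> polyA n"
  by (intro polyA_power polyA_uminus polyA_1)

lemma polyA_ann_vecs_top:
  assumes "\<And>k i. k < l \<Longrightarrow> i < n \<Longrightarrow> v k i \<in> polyA n"
  shows "ann_vecs n v l (top_coeff n) S \<in> polyA n"
  using assms
proof (induction l arbitrary: S)
  case 0
  show ?case by (simp add: top_coeff_def)
next
  case (Suc l)
  then show ?case
    by (auto simp: ann_vec_def ann_def sg_def intro!: polyA_sum polyA_mult polyA_sign)
qed

lemma polyA_bivec_power:
  assumes "\<And>i j. i < n \<Longrightarrow> j < n \<Longrightarrow> M i j \<in> polyA n"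
  shows "(bivec_op n M ^^ m) unit_coeff S \<in> polyA n"
proof (induction m arbitrary: S)
  case 0
  show ?case by (simp add: unit_coeff_def)
next
  case (Suc m)
  then show ?case
    using assms by (auto simp: bivec_op_def cre_def sg_def intro!: polyA_sum polyA_mult polyA_sign)
qed

subsection \<open>Partial derivatives and Poisson brackets\<close>

text \<open>The function under \<open>Abs_poly_mapping\<close> has finite support, being supported
  in the preimage of a finite set under an injective shift.\<close>

lemma lookup_pderiv_var:
  "Poly_Mapping.lookup (pderiv_var i p) m
    = of_nat (Poly_Mapping.lookup m i + 1) * Poly_Mapping.lookup p (m + Poly_Mapping.single i 1)"
proof -
  let ?c = "\<lambda>m. of_nat (Poly_Mapping.lookup m i + 1) * Poly_Mapping.lookup p (m + Poly_Mapping.single i 1)"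
  have "{m. ?c m \<noteq> 0} \<subseteq> (\<lambda>m. m + Poly_Mapping.single i 1) -` Poly_Mapping.keys p"
    by (auto simp: in_keys_iff)
  moreover have "finite ((\<lambda>m. m + Poly_Mapping.single i 1) -` Poly_Mapping.keys p)"
    by (intro finite_vimageI) (auto simp: inj_def)
  ultimately have "finite {m. ?c m \<noteq> 0}" by (rule finite_subset)
  then show ?thesis unfolding pderiv_var_def by (rule lookup_Abs_poly_mapping[THEN fun_cong])
qed

lemma pderiv_var_add: "pderiv_var i (p + q) = pderiv_var i p + pderiv_var i q"
  by (rule poly_mapping_eqI) (simp add: lookup_pderiv_var lookup_add algebra_simps)

lemma pderiv_var_Const: "pderiv_var i (Const c) = 0"
proof (rule poly_mapping_eqI)
  fix m :: "nat \<Rightarrow>\<^sub>0 nat"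
  have "Poly_Mapping.lookup (m + Poly_Mapping.single i 1) i \<noteq> 0" by (simp add: lookup_add)
  then have "m + Poly_Mapping.single i 1 \<noteq> 0" by (metis lookup_zero)
  then show "Poly_Mapping.lookup (pderiv_var i (Const c)) m = Poly_Mapping.lookup 0 m"
    by (simp add: lookup_pderiv_var Const_def lookup_single when_def)
qed

lemma lookup_Var_mult:
  "Poly_Mapping.lookup (Var j * p) m =
    (if Poly_Mapping.lookup m j = 0 then 0 else Poly_Mapping.lookup p (m - Poly_Mapping.single j 1))"
proof (cases "Poly_Mapping.lookup m j = 0")
  case True
  have "m \<notin> Poly_Mapping.keys (Var j * p)"
  proof
    assume "m \<in> Poly_Mapping.keys (Var j * p)"
    then obtain a b where ab: "m = a + b" "a \<in> Poly_Mapping.keys (Var j :: 'a mpoly)"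
      using keys_mult by blast
    then have "a = Poly_Mapping.single j 1" by (auto simp: Var_def split: if_splits)
    then show False using ab(1) True by (simp add: lookup_add)
  qed
  then show ?thesis using True by (simp add: in_keys_iff)
next
  case False
  then have m: "m = Poly_Mapping.single j 1 + (m - Poly_Mapping.single j 1)"
    by (intro poly_mapping_eqI) (auto simp: lookup_add lookup_minus lookup_single when_def)
  have "Poly_Mapping.lookup (Var j * p) (Poly_Mapping.single j 1 + (m - Poly_Mapping.single j 1))
      = Poly_Mapping.lookup p (m - Poly_Mapping.single j 1)"
    by (simp only: Var_def lookup_single_mult mult_1)
  then show ?thesis using m False by simp
qed

text \<open>The product rule with a variable as one factor is all that the induction
  \<open>polyA_induct\<close> asks for.\<close>

lemma pderiv_var_Var_mult:
  fixes p :: "'a::comm_ring_1 mpoly"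
  shows "pderiv_var i (Var j * p) = (if i = j then p else 0) + Var j * pderiv_var i p"
proof (rule poly_mapping_eqI)
  fix m :: "nat \<Rightarrow>\<^sub>0 nat"
  let ?s = "Poly_Mapping.single :: nat \<Rightarrow> nat \<Rightarrow> (nat \<Rightarrow>\<^sub>0 nat)"
  show "Poly_Mapping.lookup (pderiv_var i (Var j * p)) m
      = Poly_Mapping.lookup ((if i = j then p else 0) + Var j * pderiv_var i p) m"
  proof (cases "i = j")
    case True
    have "m - ?s j 1 + ?s j 1 = m" if "Poly_Mapping.lookup m j \<noteq> 0"
      using that by (intro poly_mapping_eqI) (auto simp: lookup_add lookup_minus lookup_single when_def)
    moreover have "of_nat k + 1 = (1 + of_nat (k - 1 + 1) :: 'a)" if "k \<noteq> 0" for k :: nat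
      using that by (cases k) simp_all
    ultimately show ?thesis using True
      by (cases "Poly_Mapping.lookup m j = 0")
        (simp_all add: lookup_pderiv_var lookup_Var_mult lookup_add lookup_minus distrib_right
          del: One_nat_def)
  next
    case False
    have "m + ?s i 1 - ?s j 1 = m - ?s j 1 + ?s i 1"
      using False by (intro poly_mapping_eqI) (auto simp: lookup_add lookup_minus lookup_single when_def)
    then show ?thesis using False
      by (simp add: lookup_pderiv_var lookup_Var_mult lookup_add lookup_minus lookup_single)
  qed
qed

lemma polyA_pderiv_var: "p \<in> polyA n \<Longrightarrow> pderiv_var i p \<in> polyA n"
proof -
  assume p: "p \<in> polyA n"
  have "Poly_Mapping.keys m \<subseteq> {..<n}" if "m \<in> Poly_Mapping.keys (pderiv_var i p)" for m
  proof -
    have "m + Poly_Mapping.single i 1 \<in> Poly_Mapping.keys p"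
      using that by (auto simp: in_keys_iff lookup_pderiv_var)
    then have "Poly_Mapping.keys (m + Poly_Mapping.single i 1) \<subseteq> {..<n}"
      using p unfolding polyA_def by blast
    moreover have "Poly_Mapping.keys m \<subseteq> Poly_Mapping.keys (m + Poly_Mapping.single i 1)"
      by (auto simp: in_keys_iff lookup_add)
    ultimately show ?thesis by blast
  qed
  then show ?thesis unfolding polyA_def by blast
qed

lemma polyA_induct [consumes 1, case_names Const add Var]:
  fixes p :: "'a::comm_ring_1 mpoly"
  assumes "p \<in> polyA n"
    and Const: "\<And>c. P (Const c)"
    and add: "\<And>p q. p \<in> polyA n \<Longrightarrow> q \<in> polyA n \<Longrightarrow> P p \<Longrightarrow> P q \<Longrightarrow> P (p + q)"
    and Var: "\<And>i p. i < n \<Longrightarrow> p \<in> polyA n \<Longrightarrow> P p \<Longrightarrow> P (Var i * p)"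
  shows "P p"
proof -
  have single: "P (Poly_Mapping.single m c)" if "Poly_Mapping.keys m \<subseteq> {..<n}" for m :: "nat \<Rightarrow>\<^sub>0 nat" and c
    using that
  proof (induction "\<Sum>i<n. Poly_Mapping.lookup m i" arbitrary: m)
    case 0
    then have "Poly_Mapping.lookup m i = 0" for i
      by (cases "i < n") (auto simp: in_keys_iff)
    then have "m = 0" by (intro poly_mapping_eqI) simp
    then show ?case using Const[of c] by (simp add: Const_def)
  next
    case (Suc k)
    then have "\<exists>i<n. Poly_Mapping.lookup m i \<noteq> 0"
      by (metis (no_types, lifting) lessThan_iff nat.distinct(1) sum.neutral)
    then obtain i where i: "i < n" "Poly_Mapping.lookup m i \<noteq> 0" by blast
    let ?m = "m - Poly_Mapping.single i 1"
    have m: "m = Poly_Mapping.single i 1 + ?m"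
      using i by (intro poly_mapping_eqI) (auto simp: lookup_add lookup_minus lookup_single when_def)
    have "(\<Sum>i<n. Poly_Mapping.lookup m i) = (\<Sum>j<n. if i = j then 1 else 0) + (\<Sum>i<n. Poly_Mapping.lookup ?m i)"
      by (subst m) (simp add: lookup_add lookup_single when_def sum.distrib)
    then have k: "k = (\<Sum>i<n. Poly_Mapping.lookup ?m i)" using Suc.hyps(2) i(1) by simp
    have keys: "Poly_Mapping.keys ?m \<subseteq> {..<n}"
    proof
      fix x assume "x \<in> Poly_Mapping.keys ?m"
      then have "x \<in> Poly_Mapping.keys m" by (auto simp: in_keys_iff lookup_minus)
      then show "x \<in> {..<n}" using Suc.prems by blast
    qed
    have "P (Var i * Poly_Mapping.single ?m c)"
      using i(1) polyA_single[OF keys] Suc.hyps(1)[OF k keys] by (rule Var)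
    then show ?case by (subst m) (simp only: Var_def mult_single mult_1)
  qed
  have "P (\<Sum>m\<in>K. Poly_Mapping.single m (Poly_Mapping.lookup p m))"
    if "finite K" "K \<subseteq> Poly_Mapping.keys p" for K
    using that
  proof (induction K rule: finite_induct)
    case empty
    then show ?case using Const[of 0] by (simp add: Const_def)
  next
    case (insert m K)
    then have "\<forall>m\<in>insert m K. Poly_Mapping.keys m \<subseteq> {..<n}"
      using assms(1) unfolding polyA_def by blast
    then have "P (Poly_Mapping.single m (Poly_Mapping.lookup p m) +
        (\<Sum>m\<in>K. Poly_Mapping.single m (Poly_Mapping.lookup p m)))"
      using insert by (intro add single polyA_single polyA_sum insert.IH) simp_all
    then show ?case using insert.hyps by simp
  qed
  from this[OF finite_keys order.refl] show ?thesis by (simp flip: mpoly_sum_single)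
qed

text \<open>In the first argument both sides are derivations that agree on the variables.\<close>

lemma poisson_bracket_chain:
  fixes B :: "'a::field_char_0 mpoly \<Rightarrow> 'a mpoly \<Rightarrow> 'a mpoly"
  assumes "poisson_bracket n B" "f \<in> polyA n" "g \<in> polyA n"
  shows "B f g = (\<Sum>i<n. pderiv_var i f * B (Var i) g)"
proof -
  have B_add: "B (f + h) g = B f g + B h g" and scale: "B (Const c * f) g = Const c * B f g"
    and skew: "B f h = - B h f" and leibniz: "B g (f * h) = B g f * h + f * B g h"
    if "f \<in> polyA n" "h \<in> polyA n" for c f h
    using assms(1,3) that unfolding poisson_bracket_def by blast+
  have mult: "B (f * h) g = B f g * h + f * B h g" if "f \<in> polyA n" "h \<in> polyA n" for f h
    using skew[OF polyA_mult[OF that] assms(3)] leibniz[OF that] skew[OF that(1) assms(3)] skew[OF that(2) assms(3)]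
    by simp
  show ?thesis
    using assms(2)
  proof (induction f rule: polyA_induct)
    case (Const c)
    \<comment> \<open>The product rule for 1 * 1 makes this bracket equal to its double.\<close>
    have "B 1 g = 0" using mult[of 1 1] by simp
    then have "B (Const c) g = 0" using scale[of 1 1 c] by simp
    then show ?case by (simp add: pderiv_var_Const)
  next
    case (add p q)
    then show ?case
      by (simp add: B_add pderiv_var_add distrib_right sum.distrib)
  next
    case (Var j p)
    have "(\<Sum>i<n. pderiv_var i (Var j * p) * B (Var i) g)
        = (\<Sum>i<n. (if i = j then p * B (Var i) g else 0) + Var j * (pderiv_var i p * B (Var i) g))"
      by (intro sum.cong refl) (simp add: pderiv_var_Var_mult distrib_right mult.assoc)
    also have "\<dots> = p * B (Var j) g + Var j * B p g"
      using Var by (simp add: sum.distrib sum_distrib_left)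
    finally show ?case using mult[of "Var j" p] Var by (simp add: mult.commute)
  qed
qed

lemma mat_rank_attained:
  obtains J where "J \<subseteq> {..<n}" "lin_indep n J (\<lambda>j i. M i j)" "card J = mat_rank n M"
proof -
  let ?R = "{card J | J. J \<subseteq> {..<n} \<and> lin_indep n J (\<lambda>j i. M i j)}"
  have "?R \<subseteq> card ` Pow {..<n}" by auto
  then have "finite ?R" by (rule finite_subset) simp
  moreover have "0 \<in> ?R" by (auto simp: lin_indep_def intro!: exI[of _ "{}"])
  ultimately have "mat_rank n M \<in> ?R" unfolding mat_rank_def by (intro Max_in) auto
  then show ?thesis using that by auto
qed

lemma mat_rank_le: "mat_rank n M \<le> n"
proof -
  obtain J where "J \<subseteq> {..<n}" "card J = mat_rank n M" by (rule mat_rank_attained)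
  then show ?thesis using card_mono[of "{..<n}" J] by simp
qed

lemma codim_ge2_mono: "codim_ge2 n Y \<Longrightarrow> X \<subseteq> Y \<Longrightarrow> codim_ge2 n X"
  unfolding codim_ge2_def using dim_ge_mono by blast

theorem theorem1p3:
  fixes n l :: nat
    and B :: "'a::{alg_closed_field, field_char_0} mpoly \<Rightarrow> 'a mpoly \<Rightarrow> 'a mpoly"
    and Q :: "nat \<Rightarrow> 'a mpoly"
  assumes "poisson_bracket n B"
    and "quasi_regular n B"
    and "l = poisson_index n B"
    and "admissible n B l Q"
  shows "\<exists>c::'a. c \<noteq> 0 \<and>
           wpow n (pi_bivector n B) ((n - l) div 2)
             = (\<lambda>U. Const c * j_op n (dwedge n Q l) (top_vec n) U)"
proof -
  have B_polyA: "B (Var i) (Var j) \<in> polyA n" and B_skew: "B (Var i) (Var j) = - B (Var j) (Var i)"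
    if "i < n" "j < n" for i j
    using assms(1) polyA_Var[OF that(1)] polyA_Var[OF that(2)] unfolding poisson_bracket_def by blast+
  have Q_polyA: "Q k \<in> polyA n" and Q_central: "\<And>g. g \<in> polyA n \<Longrightarrow> B (Q k) g = 0" if "k < l" for k
    using assms(4) that unfolding admissible_def poisson_centre_def by simp_all
  define M where "M \<xi> i j = eval (B (Var i) (Var j)) \<xi>" for \<xi> i j
  define v where "v \<xi> k i = eval (pderiv_var i (Q k)) \<xi>" for \<xi> k i
  \<comment> \<open>The sign collected by \<open>j_op_dwedge\<close>; it ends up in the
    constant.\<close>
  define \<epsilon> where "\<epsilon> = (((-1) ^ (n - 1)) ^ l :: 'a)"
  define P where "P m = wpow n (pi_bivector n B) m" for m
  define W where "W = j_op n (dwedge n Q l) (top_vec n)"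
  have M_skew: "M \<xi> i j = - M \<xi> j i" if "i < n" "j < n" for \<xi> i j
    using B_skew[OF that] by (simp add: M_def)
  have eval_P: "eval (P m S) \<xi> = (bivec_op n (M \<xi>) ^^ m) unit_coeff S" for m S \<xi>
    by (simp add: P_def wpow_bivector eval_bivec_power M_def[abs_def])
  have eval_W: "eval (W S) \<xi> = \<epsilon> * ann_vecs n (v \<xi>) l (top_coeff n) S" for S \<xi>
    by (simp add: W_def j_op_dwedge eval_ann_vecs_top v_def[abs_def] \<epsilon>_def)
  have \<epsilon>: "\<epsilon> \<noteq> 0" by (simp add: \<epsilon>_def)
  have P_polyA: "P m S \<in> polyA n" for m S
    unfolding P_def wpow_bivector by (rule polyA_bivec_power) (rule B_polyA)
  have W_polyA: "W S \<in> polyA n" for S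
    unfolding W_def j_op_dwedge
    by (intro polyA_mult polyA_power polyA_uminus polyA_1 polyA_ann_vecs_top polyA_pderiv_var Q_polyA)

  \<comment> \<open>Centrality of \<open>Q k\<close>, read through the chain rule: its differential
    lies in the kernel of the Poisson matrix.\<close>
  have kernel: "(\<Sum>i<n. v \<xi> k i * M \<xi> i j) = 0" if "k < l" "j < n" for \<xi> k j
  proof -
    have "0 = B (Q k) (Var j)" using Q_central that by simp
    also have "\<dots> = (\<Sum>i<n. pderiv_var i (Q k) * B (Var i) (Var j))"
      by (rule poisson_bracket_chain) (use assms(1) Q_polyA that in auto)
    finally have "eval (\<Sum>i<n. pderiv_var i (Q k) * B (Var i) (Var j)) \<xi> = eval 0 \<xi>" by simp
    then show ?thesis by (simp add: v_def M_def)
  qed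
  \<comment> \<open>Contracting a power with this differential produces a factor equal to the
    contracted bivector, which is zero by \<open>kernel\<close>.\<close>
  have annihilated: "ann_vec n (v \<xi> k) ((bivec_op n (M \<xi>) ^^ m) unit_coeff) S = 0" if "k < l" for \<xi> k m S
  proof (cases m)
    case 0
    then show ?thesis by (simp add: ann_vec_def ann_def unit_coeff_def cong: if_cong)
  next
    case (Suc m')
    have "cre_vec n (\<lambda>j. \<Sum>i<n. v \<xi> k i * M \<xi> i j) D S = 0" for D
      unfolding cre_vec_def by (rule sum.neutral) (simp add: kernel that)
    then show ?thesis
      unfolding Suc by (subst ann_vec_bivec_power[OF M_skew]) simp_all
  qed

  have degree: "of_degree n (2 * int m) ((bivec_op n (M \<xi>) ^^ m) unit_coeff)" for \<xi> m
    by (rule of_degree_bivec_power) (rule M_skew)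

  define r where "r = max_rk n B"
  have rk_le: "rk_pi n B \<xi> \<le> n" for \<xi> by (simp add: rk_pi_def mat_rank_le)
  have fin: "finite (rk_pi n B ` points n)"
    by (rule finite_subset[of _ "{..n}"]) (use rk_le in auto)
  have ne: "points n \<noteq> ({} :: (nat \<Rightarrow> 'a) set)" by (auto simp: points_def intro!: exI[of _ "\<lambda>_. 0"])
  have "r \<in> rk_pi n B ` points n" unfolding r_def max_rk_def using fin ne by (intro Max_in) auto
  then obtain \<xi>1 where \<xi>1: "\<xi>1 \<in> points n" "rk_pi n B \<xi>1 = r" by blast
  have rk_le_r: "rk_pi n B \<xi> \<le> r" if "\<xi> \<in> points n" for \<xi>
    unfolding r_def max_rk_def using fin that by (intro Max_ge) auto
  have r: "r \<le> n" "l = n - r" "n - l = r"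
    using \<xi>1(2) rk_le[of \<xi>1] assms(3) by (simp_all add: poisson_index_def r_def)

  \<comment> \<open>Rounding up is provisional: evenness of \<open>r\<close> is derived below as
    \<open>2 * m = r\<close>.\<close>
  define m where "m = (r + 1) div 2"
  have P_nonzero: "\<exists>S. eval (P m S) \<xi> \<noteq> 0" if "rk_pi n B \<xi> = r" for \<xi>
  proof -
    obtain J where J: "J \<subseteq> {..<n}" "lin_indep n J (\<lambda>j i. M \<xi> i j)" "card J = mat_rank n (M \<xi>)"
      by (rule mat_rank_attained)
    have card: "card J = r" using J(3) that by (simp add: rk_pi_def M_def[abs_def])
    \<comment> \<open>\<open>mat_rank\<close> counts independent columns,
      \<open>bivec_power_nonzero\<close> wants rows; by skewness they differ by sign.\<close>
    have "lin_indep n J (M \<xi>)"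
      unfolding lin_indep_def
    proof (intro allI impI ballI)
      fix c j assume c: "\<forall>i<n. (\<Sum>j\<in>J. c j * M \<xi> j i) = 0" and j: "j \<in> J"
      show "c j = 0"
      proof (rule lin_indepD[OF J(2) _ j])
        fix i assume i: "i < n"
        have "(\<Sum>j\<in>J. c j * M \<xi> i j) = - (\<Sum>j\<in>J. c j * M \<xi> j i)"
          unfolding sum_negf[symmetric] using J(1) i by (intro sum.cong refl) (auto simp: M_skew[of i])
        then show "(\<Sum>j\<in>J. c j * M \<xi> i j) = 0" using c i by simp
      qed
    qed
    from bivec_power_nonzero[OF M_skew J(1) this] show ?thesis
      by (simp add: eval_P m_def card)
  qed
  have W_nonzero: "\<exists>S. eval (W S) \<xi> \<noteq> 0" if indep: "lin_indep n {..<l} (v \<xi>)" for \<xi>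
  proof -
    obtain u where "dual_basis n l (v \<xi>) u" using dual_basis_exists[OF indep] by blast
    from ann_vecs_top_nonzero[OF this] show ?thesis using \<epsilon> by (simp add: eval_W)
  qed

  have "{\<xi>\<in>points n. \<forall>S. eval (P m S) \<xi> = 0} \<subseteq> sing_pi n B"
  proof
    fix \<xi> assume \<xi>: "\<xi> \<in> {\<xi>\<in>points n. \<forall>S. eval (P m S) \<xi> = 0}"
    then have "rk_pi n B \<xi> \<noteq> r" using P_nonzero by blast
    then have "rk_pi n B \<xi> < r" using rk_le_r[of \<xi>] \<xi> by simp
    then show "\<xi> \<in> sing_pi n B" using \<xi> r assms(3) by (simp add: sing_pi_def)
  qed
  then have codim_P: "codim_ge2 n {\<xi>\<in>points n. \<forall>S. eval (P m S) \<xi> = 0}"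
    using assms(2) codim_ge2_mono unfolding quasi_regular_def by blast
  have "{\<xi>\<in>points n. \<forall>S. eval (W S) \<xi> = 0} \<subseteq> jacobian_locus n l Q"
  proof
    fix \<xi> assume \<xi>: "\<xi> \<in> {\<xi>\<in>points n. \<forall>S. eval (W S) \<xi> = 0}"
    then have "\<not> lin_indep n {..<l} (v \<xi>)" using W_nonzero by blast
    then show "\<xi> \<in> jacobian_locus n l Q" using \<xi> by (simp add: jacobian_locus_def v_def[abs_def])
  qed
  then have codim_W: "codim_ge2 n {\<xi>\<in>points n. \<forall>S. eval (W S) \<xi> = 0}"
    using assms(4) codim_ge2_mono unfolding admissible_def by blast

  \<comment> \<open>At a point where both families are nonzero, the differentials are independent
    and annihilate a nonzero element of degree 2 m, so 2 m is at most n - l = r. Rounding up gives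
    the other inequality.\<close>
  have "2 * m = r"
  proof -
    obtain S where S: "eval (P m S) \<xi>1 \<noteq> 0" using P_nonzero[OF \<xi>1(2)] by blast
    obtain \<xi>2 T where \<xi>2: "\<xi>2 \<in> points n" "eval (W T) \<xi>2 \<noteq> 0"
      using codim_ge2_nonzero[OF codim_W W_polyA] by blast
    obtain \<zeta> where \<zeta>: "eval (P m S) \<zeta> \<noteq> 0" "eval (W T) \<zeta> \<noteq> 0"
      by (rule common_nonzero_point[OF \<xi>1(1) S \<xi>2])
    have "lin_indep n {..<l} (v \<zeta>)"
      using \<zeta>(2) ann_vecs_eq_0_if_dependent[of n l "v \<zeta>"] by (auto simp: eval_W)
    moreover have "(bivec_op n (M \<zeta>) ^^ m) unit_coeff S \<noteq> 0" using \<zeta>(1) by (simp add: eval_P)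
    ultimately have "2 * int m + int l \<le> int n"
      using annihilated by (intro annihilated_degree_le[OF degree, of l "v \<zeta>"]) simp_all
    then have "2 * m \<le> r" using r by linarith
    then show ?thesis by (simp add: m_def)
  qed
  then have m: "(n - l) div 2 = m" "2 * int m + int l = int n" using r by auto

  have "\<exists>c. c \<noteq> 0 \<and> (\<forall>S. P m S = Const c * W S)"
  proof (rule proportional_families[OF _ P_polyA W_polyA codim_P codim_W])
    fix \<xi> S T
    show "eval (P m S) \<xi> * eval (W T) \<xi> = eval (P m T) \<xi> * eval (W S) \<xi>"
      using annihilated_proportional[OF degree m(2), of "v \<xi>" \<xi> S T] annihilated
      by (simp add: eval_P eval_W)
  qed
  then show ?thesis unfolding m(1) P_def W_def by (auto simp: fun_eq_iff)
qed

end
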